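(* For every formula $\varphi$ of full intuitionistic propositional logic (with $\to,\wedge,\vee,\bot$) one can construct, in logarithmic space, an implicational formula $\psi$ of order at most three such that $\psi$ is intuitionistically provable if and only if $\varphi$ is intuitionistically provable.
   Context: Implicational formulas are built from propositional variables using $\to$ only. Order: an atom has order $0$, and $r(\sigma\to\tau)=\max(r(\tau),r(\sigma)+1)$; equivalently $r(\sigma_1\to\cdots\to\sigma_k\to p)=1+\max_i r(\sigma_i)$ for an atom $p$. *)

theory Defs
  imports Complex_Main
begin

datatype form = Var nat | Bot | Imp form form | Conj form form | Disj form form

inductive nd :: "form set \<Rightarrow> form \<Rightarrow> bool" where
  Assm:  "A \<in> \<Gamma> \<Longrightarrow> nd \<Gamma> A"
| ImpI:  "nd (insert A \<Gamma>) B \<Longrightarrow> nd \<Gamma> (Imp A B)"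
| ImpE:  "nd \<Gamma> (Imp A B) \<Longrightarrow> nd \<Gamma> A \<Longrightarrow> nd \<Gamma> B"
| ConjI: "nd \<Gamma> A \<Longrightarrow> nd \<Gamma> B \<Longrightarrow> nd \<Gamma> (Conj A B)"
| ConjE1: "nd \<Gamma> (Conj A B) \<Longrightarrow> nd \<Gamma> A"
| ConjE2: "nd \<Gamma> (Conj A B) \<Longrightarrow> nd \<Gamma> B"
| DisjI1: "nd \<Gamma> A \<Longrightarrow> nd \<Gamma> (Disj A B)"
| DisjI2: "nd \<Gamma> B \<Longrightarrow> nd \<Gamma> (Disj A B)"
| DisjE: "nd \<Gamma> (Disj A B) \<Longrightarrow> nd (insert A \<Gamma>) C \<Longrightarrow> nd (insert B \<Gamma>) C \<Longrightarrow> nd \<Gamma> C"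
| BotE:  "nd \<Gamma> Bot \<Longrightarrow> nd \<Gamma> A"

definition provable :: "form \<Rightarrow> bool" where
  "provable A \<longleftrightarrow> nd {} A"

fun implicational :: "form \<Rightarrow> bool" where
  "implicational (Var n) = True"
| "implicational (Imp A B) = (implicational A \<and> implicational B)"
| "implicational _ = False"

text \<open>Order: r(atom) = 0, r(A \<to> B) = max (r B) (r A + 1).  (Only meaningful on
  implicational formulas; the other clauses are irrelevant.)\<close>
fun order :: "form \<Rightarrow> nat" where
  "order (Var n) = 0"
| "order (Imp A B) = max (order B) (order A + 1)"
| "order _ = 0"

datatype sym = SVar | SZero | SOne | SEnd | SBot | SImp | SConj | SDisj

fun bin :: "nat \<Rightarrow> sym list" where
  "bin n = (if n < 2 then [if n = 0 then SZero else SOne]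
            else bin (n div 2) @ [if n mod 2 = 0 then SZero else SOne])"

fun enc :: "form \<Rightarrow> sym list" where
  "enc (Var n) = SVar # bin n @ [SEnd]"
| "enc Bot = [SBot]"
| "enc (Imp A B) = SImp # enc A @ enc B"
| "enc (Conj A B) = SConj # enc A @ enc B"
| "enc (Disj A B) = SDisj # enc A @ enc B"

text \<open>Deterministic Turing transducer: read-only two-way input tape with end markers,
  one binary work tape (blank = False), one-way write-only output tape.
  States are 0..N-1, initial state 0; the transition function returning
  None means the machine halts.\<close>

datatype dir = L | S | R
datatype cell = LEnd | REnd | Sy sym

type_synonym trans = "nat \<Rightarrow> cell \<Rightarrow> bool \<Rightarrow> (nat \<times> bool \<times> dir \<times> dir \<times> sym option) option"

record config =
  st :: nat
  ih :: nat
  tape :: "nat \<Rightarrow> bool"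
  wh :: nat
  out :: "sym list"

definition read_in :: "sym list \<Rightarrow> nat \<Rightarrow> cell" where
  "read_in x i = (if i = 0 then LEnd else if i \<le> length x then Sy (x ! (i - 1)) else REnd)"

fun move_in :: "nat \<Rightarrow> nat \<Rightarrow> dir \<Rightarrow> nat" where
  "move_in n i L = i - 1"
| "move_in n i S = i"
| "move_in n i R = min (i + 1) (n + 1)"

fun move_w :: "nat \<Rightarrow> dir \<Rightarrow> nat" where
  "move_w i L = i - 1"
| "move_w i S = i"
| "move_w i R = i + 1"

definition step :: "trans \<Rightarrow> sym list \<Rightarrow> config \<Rightarrow> config" where
  "step \<delta> x c = (case \<delta> (st c) (read_in x (ih c)) (tape c (wh c)) of
      None \<Rightarrow> c
    | Some (q', b, d1, d2, ou) \<Rightarrow>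
        \<lparr> st = q', ih = move_in (length x) (ih c) d1, tape = (tape c)(wh c := b),
          wh = move_w (wh c) d2,
          out = (case ou of None \<Rightarrow> out c | Some s \<Rightarrow> out c @ [s]) \<rparr>)"

definition halted :: "trans \<Rightarrow> sym list \<Rightarrow> config \<Rightarrow> bool" where
  "halted \<delta> x c \<longleftrightarrow> \<delta> (st c) (read_in x (ih c)) (tape c (wh c)) = None"

definition init_config :: config where
  "init_config = \<lparr> st = 0, ih = 0, tape = (\<lambda>_. False), wh = 0, out = [] \<rparr>"

definition run :: "trans \<Rightarrow> sym list \<Rightarrow> nat \<Rightarrow> config" where
  "run \<delta> x t = (step \<delta> x ^^ t) init_config"

definition wf_machine :: "nat \<Rightarrow> trans \<Rightarrow> bool" where
  "wf_machine N \<delta> \<longleftrightarrow> 0 < N \<and>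
     (\<forall>q<N. \<forall>a b q' b' d1 d2 ou. \<delta> q a b = Some (q', b', d1, d2, ou) \<longrightarrow> q' < N)"

definition computes_logspace :: "trans \<Rightarrow> real \<Rightarrow> sym list \<Rightarrow> sym list \<Rightarrow> bool" where
  "computes_logspace \<delta> c x y \<longleftrightarrow>
     (\<exists>t. halted \<delta> x (run \<delta> x t) \<and> out (run \<delta> x t) = y) \<and>
     (\<forall>t. real (wh (run \<delta> x t)) \<le> c * log 2 (real (length x) + 2))"

definition logspace_form_fun :: "(form \<Rightarrow> form) \<Rightarrow> bool" where
  "logspace_form_fun f \<longleftrightarrow>
     (\<exists>N \<delta> c. wf_machine N \<delta> \<and> (\<forall>\<phi>. computes_logspace \<delta> c (enc \<phi>) (enc (f \<phi>))))"

end

theory Submission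
  imports Defs
begin

text \<open>
  Name the subformula occurrence that starts at position \<open>i\<close> of the encoding of \<open>\<phi>\<close> by a fresh
  variable \<open>p\<^sub>i\<close> and add clauses of order at most two saying that \<open>p\<^sub>i\<close> is equivalent to the
  connective applied to the variables of its immediate subformulas; elimination of a disjunction or of
  falsity is only allowed into variables \<open>p\<^sub>r\<close>.  If the clauses imply the root variable, substituting
  the named subformulas for the variables yields a proof of \<open>\<phi>\<close>.  For the converse, formulas are interpreted
  over the sets of formulas extending the clauses, ordered by inclusion, where a variable is true if
  it is derivable and disjunction is encoded by quantifying over the \<open>p\<^sub>r\<close>; there every subformula
  is true exactly where its variable is derivable.

  Writing \<open>p\<^sub>i\<close> as the variable \<open>2\<^sup>i\<close>, whose binary code is a one followed by \<open>i\<close> zeros, lets a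
  transducer print it by counting, so it only has to maintain three counters bounded by the
  length of the input.
\<close>

section \<open>Structured programs for transducers\<close>

text \<open>The bound on the order fixes the shape of the clauses: they become antecedents of
  \<open>\<psi>\<close>, which adds one, so a clause may have order two at most. Elimination into
  arbitrary implicational formulas would be an infinite schema; finitely many atoms
  \<open>p\<^sub>r\<close> are enough as targets because truth of any formula in the model comes
  down to derivability of such atoms. Naming occurrences instead of formulas spares the transducer
  every comparison of subformulas. Two occurrences of one variable are linked only through a second
  name, built from the code of the variable itself, to which both are made equivalent. Polish
  notation suits a one-way output: a chain of implications is written by emitting
  \<open>SImp\<close> and the code of each antecedent in turn, so no clause has to be stored. As the
  space bound speaks about a concrete machine, programs carry it in their semantics and are compiled
  once and for all.\<close>

text \<open>The third argument of the tests and actions is a flag held in the finite control.\<close>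

datatype com =
    Act "cell \<Rightarrow> bool \<Rightarrow> bool \<Rightarrow> bool \<times> bool \<times> dir \<times> dir \<times> sym option"
  | Seq com com  (infixr ";;" 60)
  | If "cell \<Rightarrow> bool \<Rightarrow> bool \<Rightarrow> bool" com com
  | While "cell \<Rightarrow> bool \<Rightarrow> bool \<Rightarrow> bool" com

type_synonym mem = "bool \<times> nat \<times> (nat \<Rightarrow> bool) \<times> nat \<times> sym list"

text \<open>A big-step derivation already certifies termination, and the index \<open>W\<close>
  makes every action certify the work head position it leads to. Exhibiting one derivation therefore
  settles halting, output and space together. Tests do not move the head, so only actions carry the
  bound.\<close>

inductive exec :: "nat \<Rightarrow> sym list \<Rightarrow> com \<Rightarrow> mem \<Rightarrow> mem \<Rightarrow> bool" for W x where
  exec_Act: "F (read_in x h) (tp w) f = (f', b, d1, d2, ou) \<Longrightarrow> move_w w d2 \<le> W \<Longrightarrow>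
    exec W x (Act F) (f, h, tp, w, out0)
      (f', move_in (length x) h d1, tp(w := b), move_w w d2,
       case ou of None \<Rightarrow> out0 | Some s \<Rightarrow> out0 @ [s])"
| exec_Seq: "exec W x c1 s s1 \<Longrightarrow> exec W x c2 s1 s2 \<Longrightarrow> exec W x (c1 ;; c2) s s2"
| exec_IfT: "P (read_in x h) (tp w) f \<Longrightarrow> exec W x c1 (f, h, tp, w, out0) s2 \<Longrightarrow>
    exec W x (If P c1 c2) (f, h, tp, w, out0) s2"
| exec_IfF: "\<not> P (read_in x h) (tp w) f \<Longrightarrow> exec W x c2 (f, h, tp, w, out0) s2 \<Longrightarrow>
    exec W x (If P c1 c2) (f, h, tp, w, out0) s2"
| exec_WhileF: "\<not> P (read_in x h) (tp w) f \<Longrightarrow>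
    exec W x (While P c) (f, h, tp, w, out0) (f, h, tp, w, out0)"
| exec_WhileT: "P (read_in x h) (tp w) f \<Longrightarrow> exec W x c (f, h, tp, w, out0) s1 \<Longrightarrow>
    exec W x (While P c) s1 s2 \<Longrightarrow> exec W x (While P c) (f, h, tp, w, out0) s2"

section \<open>Compilation of programs to transition tables\<close>

type_synonym row = "cell \<Rightarrow> bool \<Rightarrow> bool \<Rightarrow> nat \<times> bool \<times> bool \<times> dir \<times> dir \<times> sym option"

fun len :: "com \<Rightarrow> nat" where
  "len (Act F) = 1"
| "len (c1 ;; c2) = len c1 + len c2"
| "len (If P c1 c2) = 2 + len c1 + len c2"
| "len (While P c) = 2 + len c"

definition branch :: "(cell \<Rightarrow> bool \<Rightarrow> bool \<Rightarrow> bool) \<Rightarrow> nat \<Rightarrow> nat \<Rightarrow> row" where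
  "branch P i j = (\<lambda>a b f. (if P a b f then i else j, f, b, S, S, None))"

text \<open>Addresses are absolute: a block loaded at \<open>i\<close> is left at
  \<open>i + len c\<close>. A conditional spends one state on its test and one on the jump over the
  second branch, a loop one on its test and one on the jump back. An unconditional jump is a branch
  on a constant test, with 0 filling its other target.\<close>

fun code :: "nat \<Rightarrow> com \<Rightarrow> nat \<Rightarrow> row" where
  "code i (Act F) q = (\<lambda>a b f. (i + 1, F a b f))"
| "code i (c1 ;; c2) q = (if q < i + len c1 then code i c1 q else code (i + len c1) c2 q)"
| "code i (If P c1 c2) q =
    (if q = i then branch P (i + 1) (i + 2 + len c1)
     else if q < i + 1 + len c1 then code (i + 1) c1 q
     else if q = i + 1 + len c1 then branch (\<lambda>_ _ _. True) (i + 2 + len c1 + len c2) 0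
     else code (i + 2 + len c1) c2 q)"
| "code i (While P c) q =
    (if q = i then branch P (i + 1) (i + 2 + len c)
     else if q < i + 1 + len c then code (i + 1) c q
     else branch (\<lambda>_ _ _. True) i 0)"

lemma code_target: "i \<le> q \<Longrightarrow> q < i + len c \<Longrightarrow> fst (code i c q a b f) \<le> i + len c"
proof (induction i c q rule: code.induct)
  case (2 i c1 c2 q)
  show ?case
  proof (cases "q < i + len c1")
    case True
    with 2(1) 2(3) have "fst (code i c1 q a b f) \<le> i + len c1" by blast
    with True show ?thesis by simp
  next
    case False
    with 2(2) 2(4) have "fst (code (i + len c1) c2 q a b f) \<le> i + len c1 + len c2" by simp
    with False show ?thesis by simp
  qed
next
  case (3 i P c1 c2 q)
  consider "q = i" | "q = i + 1 + len c1" | "i < q" "q < i + 1 + len c1" | "i + 1 + len c1 < q"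
    using 3(3) by linarith
  then show ?case
  proof cases
    case 3
    with "3.IH"(1) have "fst (code (i + 1) c1 q a b f) \<le> i + 1 + len c1" by simp
    with 3 show ?thesis by simp
  next
    case 4
    with "3.IH"(2) "3.prems" have "fst (code (i + 2 + len c1) c2 q a b f) \<le> i + 2 + len c1 + len c2" by simp
    with 4 show ?thesis by simp
  qed (simp_all add: branch_def)
next
  case (4 i P c q)
  consider "q = i" | "q = i + 1 + len c" | "i < q" "q < i + 1 + len c"
    using 4(2,3) by fastforce
  then show ?case
  proof cases
    case 3
    with "4.IH" have "fst (code (i + 1) c q a b f) \<le> i + 1 + len c" by simp
    with 3 show ?thesis by simp
  qed (simp_all add: branch_def)
qed auto

text \<open>The flag is the parity of the state and the program address is its half. The exit
  address \<open>len c\<close> thus yields the two halting states \<open>2 * len c\<close> and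
  \<open>2 * len c + 1\<close>.\<close>

definition machine :: "com \<Rightarrow> trans" where
  "machine c q a b = (if q < 2 * len c then
     (case code 0 c (q div 2) a b (odd q) of
       (p, f, rest) \<Rightarrow> Some (2 * p + of_bool f, rest)) else None)"

fun conf :: "nat \<Rightarrow> mem \<Rightarrow> config" where
  "conf i (f, h, tp, w, out0) = \<lparr>st = 2 * i + of_bool f, ih = h, tape = tp, wh = w, out = out0\<rparr>"

text \<open>The bound concerns the configuration before the step, so along a run it covers all
  configurations but the last; \<open>exec_machine\<close> delivers that one as its second
  conjunct.\<close>

definition bounded_step :: "trans \<Rightarrow> sym list \<Rightarrow> nat \<Rightarrow> config \<Rightarrow> config \<Rightarrow> bool" where
  "bounded_step \<delta> x W c c' \<longleftrightarrow> c' = step \<delta> x c \<and> wh c \<le> W"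

lemma machine_step:
  assumes "q < len c" "code 0 c q (read_in x h) (tp w) f = (q', f', b, d1, d2, ou)" "w \<le> W"
  shows "bounded_step (machine c) x W (conf q (f, h, tp, w, out0))
    (conf q' (f', move_in (length x) h d1, tp(w := b), move_w w d2,
       case ou of None \<Rightarrow> out0 | Some s \<Rightarrow> out0 @ [s]))"
  using assms by (auto simp: bounded_step_def step_def machine_def split: option.split)

lemma branch_step:
  assumes "q < len c" "code 0 c q = branch P i j" "w \<le> W"
  shows "bounded_step (machine c) x W (conf q (f, h, tp, w, out0))
    (conf (if P (read_in x h) (tp w) f then i else j) (f, h, tp, w, out0))"
  using machine_step[of q c x h tp w f "if P (read_in x h) (tp w) f then i else j" f "tp w" S S None W out0] assms
  by (simp add: branch_def)

text \<open>With absolute addresses, being part of \<open>p\<close> is plain agreement of rows, so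
  the simulation can descend into subprograms without relocating anything.\<close>

definition loaded :: "com \<Rightarrow> nat \<Rightarrow> com \<Rightarrow> bool" where
  "loaded p i c \<longleftrightarrow> i + len c \<le> len p \<and> (\<forall>q. i \<le> q \<and> q < i + len c \<longrightarrow> code 0 p q = code i c q)"

lemma loaded_self: "loaded p 0 p" by (simp add: loaded_def)

lemma loaded_Seq: "loaded p i (c1 ;; c2) \<Longrightarrow> loaded p i c1 \<and> loaded p (i + len c1) c2"
  by (auto simp: loaded_def)

lemma loaded_If: "loaded p i (If P c1 c2) \<Longrightarrow>
    loaded p (i + 1) c1 \<and> loaded p (i + 2 + len c1) c2 \<and> i + 2 + len c1 + len c2 \<le> len p \<and>
    code 0 p i = branch P (i + 1) (i + 2 + len c1) \<and>
    code 0 p (i + 1 + len c1) = branch (\<lambda>_ _ _. True) (i + 2 + len c1 + len c2) 0"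
  by (auto simp: loaded_def)

lemma loaded_While: "loaded p i (While P c) \<Longrightarrow>
    loaded p (i + 1) c \<and> i + 2 + len c \<le> len p \<and>
    code 0 p i = branch P (i + 1) (i + 2 + len c) \<and>
    code 0 p (i + 1 + len c) = branch (\<lambda>_ _ _. True) i 0"
  by (auto simp: loaded_def)

text \<open>Simulation by induction on the derivation. In the loop case the second subderivation
  concerns the same loop at the same address, which the jump at the end of the body reaches again.
  The address in \<open>conf 0\<close> is arbitrary and serves to project the work head out of a
  memory state.\<close>

lemma exec_machine:
  assumes "exec W x c s t" "loaded p i c" "wh (conf 0 s) \<le> W"
  shows "(bounded_step (machine p) x W)\<^sup>*\<^sup>* (conf i s) (conf (i + len c) t) \<and> wh (conf 0 t) \<le> W"
  using assms
proof (induction arbitrary: i rule: exec.induct)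
  case (exec_Act F h tp w f f' b d1 d2 ou out0)
  then have "code 0 p i (read_in x h) (tp w) f = (i + 1, f', b, d1, d2, ou)" "i < len p"
    by (auto simp: loaded_def)
  with machine_step[of i p x h tp w f "i + 1" f' b d1 d2 ou W out0] exec_Act show ?case by auto
next
  case (exec_Seq c1 s s1 c2 s2)
  note l = loaded_Seq[OF exec_Seq.prems(1)]
  from exec_Seq.IH(1)[of i] l exec_Seq.prems
  have 1: "(bounded_step (machine p) x W)\<^sup>*\<^sup>* (conf i s) (conf (i + len c1) s1)" "wh (conf 0 s1) \<le> W"
    by auto
  from exec_Seq.IH(2)[of "i + len c1"] l 1(2) 1(1) show ?case
    by (auto simp: add.assoc)
next
  case (exec_IfT P h tp w f c1 out0 s2 c2)
  note l = loaded_If[OF exec_IfT.prems(1)]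
  have w: "w \<le> W" using exec_IfT.prems by simp
  have 1: "bounded_step (machine p) x W (conf i (f, h, tp, w, out0)) (conf (i + 1) (f, h, tp, w, out0))"
    using branch_step[of i p P "i + 1" "i + 2 + len c1" w W x f h tp out0] l w exec_IfT.hyps by simp
  from exec_IfT.IH[of "i + 1"] l exec_IfT.prems
  have 2: "(bounded_step (machine p) x W)\<^sup>*\<^sup>* (conf (i + 1) (f, h, tp, w, out0)) (conf (i + 1 + len c1) s2)"
    "wh (conf 0 s2) \<le> W" by auto
  obtain f' h' tp' w' o' where s2: "s2 = (f', h', tp', w', o')" by (cases s2)
  have "bounded_step (machine p) x W (conf (i + 1 + len c1) s2) (conf (i + 2 + len c1 + len c2) s2)"
    using branch_step[of "i + 1 + len c1" p "\<lambda>_ _ _. True" "i + 2 + len c1 + len c2" 0 w' W x f' h' tp' o'] l 2(2)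
    by (simp add: s2)
  with 1 2 show ?case
    by (metis (no_types, lifting) converse_rtranclp_into_rtranclp len.simps(3) add.assoc rtranclp.rtrancl_into_rtrancl)
next
  case (exec_IfF P h tp w f c2 out0 s2 c1)
  note l = loaded_If[OF exec_IfF.prems(1)]
  have w: "w \<le> W" using exec_IfF.prems by simp
  have 1: "bounded_step (machine p) x W (conf i (f, h, tp, w, out0)) (conf (i + 2 + len c1) (f, h, tp, w, out0))"
    using branch_step[of i p P "i + 1" "i + 2 + len c1" w W x f h tp out0] l w exec_IfF.hyps by simp
  from exec_IfF.IH[of "i + 2 + len c1"] l exec_IfF.prems
  have 2: "(bounded_step (machine p) x W)\<^sup>*\<^sup>* (conf (i + 2 + len c1) (f, h, tp, w, out0)) (conf (i + 2 + len c1 + len c2) s2)"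
    "wh (conf 0 s2) \<le> W" by auto
  with 1 show ?case
    by (metis (no_types, lifting) converse_rtranclp_into_rtranclp len.simps(3) add.assoc)
next
  case (exec_WhileF P h tp w f c out0)
  note l = loaded_While[OF exec_WhileF.prems(1)]
  show ?case
    using branch_step[of i p P "i + 1" "i + 2 + len c" w W x f h tp out0] l exec_WhileF
    by (auto simp: add.assoc)
next
  case (exec_WhileT P h tp w f c out0 s1 s2)
  note l = loaded_While[OF exec_WhileT.prems(1)]
  have w: "w \<le> W" using exec_WhileT.prems by simp
  have 1: "bounded_step (machine p) x W (conf i (f, h, tp, w, out0)) (conf (i + 1) (f, h, tp, w, out0))"
    using branch_step[of i p P "i + 1" "i + 2 + len c" w W x f h tp out0] l w exec_WhileT.hyps by simp
  from exec_WhileT.IH(1)[of "i + 1"] l exec_WhileT.prems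
  have 2: "(bounded_step (machine p) x W)\<^sup>*\<^sup>* (conf (i + 1) (f, h, tp, w, out0)) (conf (i + 1 + len c) s1)"
    "wh (conf 0 s1) \<le> W" by auto
  obtain f' h' tp' w' o' where s1: "s1 = (f', h', tp', w', o')" by (cases s1)
  have 3: "bounded_step (machine p) x W (conf (i + 1 + len c) s1) (conf i s1)"
    using branch_step[of "i + 1 + len c" p "\<lambda>_ _ _. True" i 0 w' W x f' h' tp' o'] l 2(2)
    by (simp add: s1)
  from exec_WhileT.IH(2)[OF exec_WhileT.prems(1) 2(2)]
  have 4: "(bounded_step (machine p) x W)\<^sup>*\<^sup>* (conf i s1) (conf (i + len (While P c)) s2)" "wh (conf 0 s2) \<le> W"
    by auto
  have "(bounded_step (machine p) x W)\<^sup>*\<^sup>* (conf i (f, h, tp, w, out0)) (conf i s1)"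
    using 1 2(1) 3 by (meson converse_rtranclp_into_rtranclp rtranclp.rtrancl_into_rtrancl)
  with 4 show ?case by (meson rtranclp_trans)
qed

lemma bounded_run:
  assumes "(bounded_step \<delta> x W)\<^sup>*\<^sup>* c c'"
  shows "\<exists>t. (step \<delta> x ^^ t) c = c' \<and> (\<forall>t'<t. wh ((step \<delta> x ^^ t') c) \<le> W)"
  using assms
proof (induction rule: rtranclp_induct)
  case base then show ?case by (intro exI[of _ 0]) simp
next
  case (step y z)
  then obtain t where "(Defs.step \<delta> x ^^ t) c = y" "\<forall>t'<t. wh ((Defs.step \<delta> x ^^ t') c) \<le> W" by blast
  with step.hyps(2) show ?case
    by (intro exI[of _ "Suc t"]) (auto simp: bounded_step_def less_Suc_eq)
qed

lemma wf_machine_machine: "wf_machine (2 * len c + 2) (machine c)"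
  unfolding wf_machine_def
proof (intro conjI allI impI)
  fix q a b q' b' d1 d2 ou
  assume *: "machine c q a b = Some (q', b', d1, d2, ou)"
  then have q: "q < 2 * len c" by (auto simp: machine_def split: if_splits)
  obtain p f r where p: "code 0 c (q div 2) a b (odd q) = (p, f, r)" by (metis prod_cases3)
  with code_target[of 0 "q div 2" c a b "odd q"] q have "p \<le> len c" by auto
  moreover have "q' = 2 * p + of_bool f" using * q p by (auto simp: machine_def)
  ultimately show "q' < 2 * len c + 2" by (cases f) auto
qed simp

lemma exec_computes:
  assumes "exec W x c (False, 0, \<lambda>_. False, 0, []) (f, h, tp, w, y)"
    and "real W \<le> k * log 2 (real (length x) + 2)"
  shows "computes_logspace (machine c) k x y"
proof -
  let ?s = "\<lambda>t. (step (machine c) x ^^ t) init_config"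
  have i: "conf 0 (False, 0, \<lambda>_. False, 0, []) = init_config" by (simp add: init_config_def)
  from exec_machine[OF assms(1) loaded_self] i
  have "(bounded_step (machine c) x W)\<^sup>*\<^sup>* init_config (conf (len c) (f, h, tp, w, y))" and w: "w \<le> W"
    by auto
  from bounded_run[OF this(1)] obtain t where
    t: "?s t = conf (len c) (f, h, tp, w, y)" "\<forall>t'<t. wh (?s t') \<le> W" by blast
  have h: "halted (machine c) x (?s t)" unfolding t halted_def by (simp add: machine_def)
  \<comment> \<open>The space bound ranges over all times; a halted machine repeats its
    configuration, so times after \<open>t\<close> reduce to \<open>t\<close>.\<close>
  have stay: "?s (t + d) = ?s t" for d
  proof (induction d)
    case (Suc d)
    have "step (machine c) x (?s t) = ?s t" using h by (simp add: step_def halted_def)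
    with Suc show ?case by simp
  qed simp
  have "wh (?s t') \<le> W" for t'
  proof (cases "t' < t")
    case False
    then have "?s t' = ?s t" using stay[of "t' - t"] by simp
    then show ?thesis using t w by simp
  qed (use t in auto)
  then have "\<forall>t'. real (wh (?s t')) \<le> k * log 2 (real (length x) + 2)"
    using assms(2) by (meson of_nat_le_iff order_trans)
  with h show ?thesis unfolding computes_logspace_def run_def
    by (intro conjI exI[of _ t]) (auto simp: t)
qed

section \<open>Binary counters on the work tape\<close>

definition emit_sym :: "sym \<Rightarrow> com" where
  "emit_sym a = Act (\<lambda>_ b f. (f, b, S, S, Some a))"
definition head :: "dir \<Rightarrow> com" where
  "head d = Act (\<lambda>_ b f. (f, b, d, S, None))"
definition work :: "dir \<Rightarrow> com" where
  "work d = Act (\<lambda>_ b f. (f, b, S, d, None))"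
definition put_bit :: "bool \<Rightarrow> com" where
  "put_bit b = Act (\<lambda>_ _ f. (f, b, S, S, None))"
definition get_flag :: com where
  "get_flag = Act (\<lambda>_ b _. (b, b, S, S, None))"
definition clear_flag :: com where
  "clear_flag = Act (\<lambda>_ b _. (False, b, S, S, None))"

lemma Act_eq:
  assumes "F (read_in x h) (tp w) f = (f', b, d1, d2, ou)" "move_w w d2 \<le> W"
    "t = (f', move_in (length x) h d1, tp(w := b), move_w w d2,
       case ou of None \<Rightarrow> out0 | Some s \<Rightarrow> out0 @ [s])"
  shows "exec W x (Act F) (f, h, tp, w, out0) t"
  using exec_Act[of F x h tp w f f' b d1 d2 ou W out0] assms by simp

fun works :: "dir \<Rightarrow> nat \<Rightarrow> com" where
  "works d 0 = work S"
| "works d (Suc k) = work d ;; works d k"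

lemma exec_work: "move_w w d \<le> W \<Longrightarrow> exec W x (work d) (f, h, tp, w, ou) (f, h, tp, move_w w d, ou)"
  unfolding work_def by (rule Act_eq, rule refl) simp_all

lemma exec_put_bit: "w \<le> W \<Longrightarrow> exec W x (put_bit b) (f, h, tp, w, ou) (f, h, tp(w := b), w, ou)"
  unfolding put_bit_def by (rule Act_eq, rule refl) simp_all

lemma exec_get_flag: "w \<le> W \<Longrightarrow> exec W x get_flag (f, h, tp, w, ou) (tp w, h, tp, w, ou)"
  unfolding get_flag_def by (rule Act_eq, rule refl) simp_all

lemma exec_clear_flag: "w \<le> W \<Longrightarrow> exec W x clear_flag (f, h, tp, w, ou) (False, h, tp, w, ou)"
  unfolding clear_flag_def by (rule Act_eq, rule refl) simp_all

lemma exec_right: "w + k \<le> W \<Longrightarrow> exec W x (works R k) (f, h, tp, w, ou) (f, h, tp, w + k, ou)"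
proof (induction k arbitrary: w)
  case 0
  then show ?case using exec_work[of w S] by simp
next
  case (Suc k)
  have "exec W x (work R) (f, h, tp, w, ou) (f, h, tp, w + 1, ou)"
    using exec_work[of w R] Suc.prems by simp
  with Suc.IH[of "w + 1"] Suc.prems show ?case by (auto intro: exec_Seq)
qed

lemma exec_left: "w + k \<le> W \<Longrightarrow> exec W x (works L k) (f, h, tp, w + k, ou) (f, h, tp, w, ou)"
proof (induction k)
  case 0
  then show ?case using exec_work[of w S] by simp
next
  case (Suc k)
  have "exec W x (work L) (f, h, tp, w + Suc k, ou) (f, h, tp, w + k, ou)"
    using exec_work[of "w + Suc k" L] Suc.prems by simp
  with Suc show ?case by (auto intro: exec_Seq)
qed

text \<open>The tape is read in blocks of five cells whose first cell is set only in block 0, so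
  strides of five from the start of any block stop exactly at the left end.\<close>

definition home :: com where
  "home = While (\<lambda>_ b _. \<not> b) (works L 5)"

lemma exec_home:
  assumes "tp 0" "\<forall>m>0. \<not> tp (5 * m)" "5 * m \<le> W"
  shows "exec W x home (f, h, tp, 5 * m, ou) (f, h, tp, 0, ou)"
  using assms(3)
proof (induction m)
  case 0
  then show ?case using assms(1) unfolding home_def by (auto intro: exec_WhileF)
next
  case (Suc m)
  have 1: "exec W x (works L 5) (f, h, tp, 5 * Suc m, ou) (f, h, tp, 5 * m, ou)"
    using exec_left[of "5 * m" 5 W] Suc.prems by (simp add: algebra_simps)
  show ?case unfolding home_def
    by (rule exec_WhileT[OF _ 1]) (use assms(2) Suc in \<open>auto simp: home_def\<close>)
qed

text \<open>The starting block \<open>m\<close> is a parameter because carries and scans recurse on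
  the higher bits, that is on \<open>N div 2\<close> from block \<open>Suc m\<close>. Ranging over
  all \<open>k\<close> forces the cells beyond the leading bit to be blank.\<close>

definition num :: "(nat \<Rightarrow> bool) \<Rightarrow> nat \<Rightarrow> nat \<Rightarrow> nat \<Rightarrow> bool" where
  "num tp j m N \<longleftrightarrow> (\<forall>k. tp (5 * (m + k) + j) = odd (N div 2 ^ k))"

lemma num_step: "num tp j m N \<longleftrightarrow> tp (5 * m + j) = odd N \<and> num tp j (Suc m) (N div 2)"
proof -
  have "(\<forall>k. Q k) \<longleftrightarrow> Q 0 \<and> (\<forall>k. Q (Suc k))" for Q :: "nat \<Rightarrow> bool"
    by (metis not0_implies_Suc)
  from this[of "\<lambda>k. tp (5 * (m + k) + j) = odd (N div 2 ^ k)"]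
  have "num tp j m N \<longleftrightarrow> tp (5 * m + j) = odd N \<and>
      (\<forall>k. tp (5 * (m + Suc k) + j) = odd (N div 2 ^ Suc k))" unfolding num_def by simp
  moreover have "N div 2 ^ Suc k = N div 2 div 2 ^ k" for k by (simp add: div_mult2_eq)
  moreover have "m + Suc k = Suc m + k" for k by simp
  ultimately show ?thesis unfolding num_def by (simp only:)
qed

lemma num_cong: "(\<And>k. m \<le> k \<Longrightarrow> tp (5 * k + j) = tp' (5 * k + j)) \<Longrightarrow> num tp j m N = num tp' j m N"
proof -
  assume "\<And>k. m \<le> k \<Longrightarrow> tp (5 * k + j) = tp' (5 * k + j)"
  then have "tp (5 * (m + k) + j) = tp' (5 * (m + k) + j)" for k using le_add1 by blast
  then show ?thesis unfolding num_def by (simp only:)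
qed

text \<open>For \<open>True\<close> this is binary increment: ones turn into zeros until a zero
  turns into a one. Exchanging the two bits gives decrement.\<close>

definition carry :: "bool \<Rightarrow> com" where
  "carry b = While (\<lambda>_ b' _. b' = b) (put_bit (\<not> b) ;; works R 5) ;; put_bit b"

lemma exec_carry_stop:
  assumes "tp w \<noteq> b" "w \<le> W"
  shows "exec W x (carry b) (f, h, tp, w, ou) (f, h, tp(w := b), w, ou)"
  unfolding carry_def using assms by (auto intro!: exec_Seq exec_WhileF exec_put_bit)

lemma exec_carry_go:
  assumes "tp w = b" "w + 5 \<le> W" "exec W x (carry b) (f, h, tp', w', ou) s"
    "tp' = tp(w := \<not> b)" "w' = w + 5"
  shows "exec W x (carry b) (f, h, tp, w, ou) s"
proof -
  from assms(3)[unfolded assms(4,5)] obtain s1 where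
    s1: "exec W x (While (\<lambda>_ b' _. b' = b) (put_bit (\<not> b) ;; works R 5)) (f, h, tp(w := \<not> b), w + 5, ou) s1"
    "exec W x (put_bit b) s1 s"
    unfolding carry_def by (auto elim: exec.cases)
  have "exec W x (put_bit (\<not> b) ;; works R 5) (f, h, tp, w, ou) (f, h, tp(w := \<not> b), w + 5, ou)"
    using assms(2) by (intro exec_Seq[OF exec_put_bit exec_right]) auto
  with s1(1) have "exec W x (While (\<lambda>_ b' _. b' = b) (put_bit (\<not> b) ;; works R 5)) (f, h, tp, w, ou) s1"
    using assms(1) by (auto intro: exec_WhileT)
  with s1(2) show ?thesis unfolding carry_def by (auto intro: exec_Seq)
qed

lemma carry_stop:
  assumes "tp (5 * m + j) \<noteq> b" "5 * m + j \<le> W" "num tp j (Suc m) (N div 2)" "odd N = b"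
  obtains tp' where "exec W x (carry b) (f, h, tp, 5 * m + j, ou) (f, h, tp', 5 * m + j, ou)"
    "num tp' j m N" "\<forall>p. (\<forall>i\<ge>m. p \<noteq> 5 * i + j) \<longrightarrow> tp' p = tp p"
proof
  let ?tp = "tp(5 * m + j := b)"
  show "exec W x (carry b) (f, h, tp, 5 * m + j, ou) (f, h, ?tp, 5 * m + j, ou)"
    by (rule exec_carry_stop) fact+
  have "num ?tp j (Suc m) (N div 2)"
    using assms(3) num_cong[of "Suc m" tp j ?tp "N div 2"] by simp
  then show "num ?tp j m N" using assms(4) by (subst num_step) simp
qed simp

text \<open>The stopping block \<open>e\<close> is reported because the caller has to mark it as in
  use. It lies beyond the given \<open>k\<close> bits only if the carry overflows, and then
  \<open>N + 1\<close> is exactly \<open>2 ^ k\<close>; this later limits the growth of the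
  tape.\<close>

lemma exec_carry_inc:
  assumes "num tp j m N" "N < 2 ^ k" "5 * (m + k) + j \<le> W" "j < 5"
  shows "\<exists>e tp'. exec W x (carry True) (f, h, tp, 5 * m + j, ou) (f, h, tp', 5 * e + j, ou) \<and>
    m \<le> e \<and> e \<le> m + k \<and> (if e = m + k then N + 1 = 2 ^ k else N + 1 < 2 ^ k) \<and>
    num tp' j m (N + 1) \<and> (\<forall>p. (\<forall>i\<ge>m. p \<noteq> 5 * i + j) \<longrightarrow> tp' p = tp p)"
  using assms
proof (induction k arbitrary: tp m N)
  case 0
  then have "\<not> tp (5 * m + j)" "num tp j (Suc m) (1 div 2)" "N = 0" by (auto simp: num_step[of tp j m])
  with 0 carry_stop[of tp m j True W 1 x f h ou] obtain tp' where
    "exec W x (carry True) (f, h, tp, 5 * m + j, ou) (f, h, tp', 5 * m + j, ou)"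
    "num tp' j m 1" "\<forall>p. (\<forall>i\<ge>m. p \<noteq> 5 * i + j) \<longrightarrow> tp' p = tp p" by auto
  with \<open>N = 0\<close> show ?case by (intro exI[of _ m] exI[of _ tp']) simp
next
  case (Suc k)
  from Suc.prems(1) have b: "tp (5 * m + j) = odd N" "num tp j (Suc m) (N div 2)"
    by (simp_all add: num_step[of tp j m])
  show ?case
  proof (cases "odd N")
    case False
    from False b have "\<not> tp (5 * m + j)" "num tp j (Suc m) ((N + 1) div 2)" by simp_all
    with Suc.prems False carry_stop[of tp m j True W "N + 1" x f h ou] obtain tp' where
      "exec W x (carry True) (f, h, tp, 5 * m + j, ou) (f, h, tp', 5 * m + j, ou)"
      "num tp' j m (N + 1)" "\<forall>p. (\<forall>i\<ge>m. p \<noteq> 5 * i + j) \<longrightarrow> tp' p = tp p" by auto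
    moreover have "N + 1 < 2 ^ Suc k" using False Suc.prems(2)
      by (metis Suc_eq_plus1 Suc_lessI even_Suc even_power even_numeral zero_less_Suc)
    ultimately show ?thesis by (intro exI[of _ m] exI[of _ tp']) simp
  next
    case True
    let ?tp = "tp(5 * m + j := False)"
    have n: "num ?tp j (Suc m) (N div 2)"
      using b(2) num_cong[of "Suc m" tp j ?tp "N div 2"] by simp
    have lt: "N div 2 < 2 ^ k" using Suc.prems(2) by auto
    have w: "5 * (Suc m + k) + j \<le> W" using Suc.prems(3) by simp
    from Suc.IH[OF n lt w Suc.prems(4)] obtain e tp' where
      1: "exec W x (carry True) (f, h, ?tp, 5 * Suc m + j, ou) (f, h, tp', 5 * e + j, ou)"
      and e: "Suc m \<le> e" "e \<le> Suc m + k"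
        "if e = Suc m + k then N div 2 + 1 = 2 ^ k else N div 2 + 1 < 2 ^ k"
      and n': "num tp' j (Suc m) (N div 2 + 1)"
      and same: "\<forall>p. (\<forall>i\<ge>Suc m. p \<noteq> 5 * i + j) \<longrightarrow> tp' p = ?tp p"
      by blast
    have "tp' (5 * m + j) = False" using same by simp
    moreover have N: "N + 1 = 2 * (N div 2 + 1)" "(N + 1) div 2 = N div 2 + 1" using True by presburger+
    ultimately have "num tp' j m (N + 1)" using n' True unfolding num_step[of tp' j m] by auto
    moreover have "exec W x (carry True) (f, h, tp, 5 * m + j, ou) (f, h, tp', 5 * e + j, ou)"
      using b(1) True Suc.prems(3) by (intro exec_carry_go[OF _ _ 1]) simp_all
    moreover have "if e = m + Suc k then N + 1 = 2 ^ Suc k else N + 1 < 2 ^ Suc k"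
      using e(3) N by (auto split: if_splits)
    moreover have "\<forall>p. (\<forall>i\<ge>m. p \<noteq> 5 * i + j) \<longrightarrow> tp' p = tp p" using same by auto
    ultimately show ?thesis using e by (intro exI[of _ e] exI[of _ tp']) auto
  qed
qed

text \<open>Positivity of \<open>N\<close> makes the borrow meet a one among the \<open>k\<close>
  bits, so the head stays within them.\<close>

lemma exec_carry_dec:
  assumes "num tp j m N" "0 < N" "N < 2 ^ k" "5 * (m + k) + j \<le> W" "j < 5"
  shows "\<exists>e tp'. exec W x (carry False) (f, h, tp, 5 * m + j, ou) (f, h, tp', 5 * e + j, ou) \<and>
    m \<le> e \<and> e < m + k \<and>
    num tp' j m (N - 1) \<and> (\<forall>p. (\<forall>i\<ge>m. p \<noteq> 5 * i + j) \<longrightarrow> tp' p = tp p)"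
  using assms
proof (induction k arbitrary: tp m N)
  case (Suc k)
  from Suc.prems(1) have b: "tp (5 * m + j) = odd N" "num tp j (Suc m) (N div 2)"
    by (simp_all add: num_step[of tp j m])
  show ?case
  proof (cases "odd N")
    case True
    from True b have "tp (5 * m + j)" "num tp j (Suc m) ((N - 1) div 2)" by (auto elim: oddE)
    with Suc.prems True carry_stop[of tp m j False W "N - 1" x f h ou] obtain tp' where
      "exec W x (carry False) (f, h, tp, 5 * m + j, ou) (f, h, tp', 5 * m + j, ou)"
      "num tp' j m (N - 1)" "\<forall>p. (\<forall>i\<ge>m. p \<noteq> 5 * i + j) \<longrightarrow> tp' p = tp p" by auto
    then show ?thesis by (intro exI[of _ m] exI[of _ tp']) simp
  next
    case False
    let ?tp = "tp(5 * m + j := True)"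
    have n: "num ?tp j (Suc m) (N div 2)"
      using b(2) num_cong[of "Suc m" tp j ?tp "N div 2"] by simp
    have lt: "0 < N div 2" "N div 2 < 2 ^ k" using Suc.prems False by (auto intro: Nat.gr0I)
    have w: "5 * (Suc m + k) + j \<le> W" using Suc.prems(4) by simp
    from Suc.IH[OF n lt w Suc.prems(5)] obtain e tp' where
      1: "exec W x (carry False) (f, h, ?tp, 5 * Suc m + j, ou) (f, h, tp', 5 * e + j, ou)"
      and e: "Suc m \<le> e" "e < Suc m + k"
      and n': "num tp' j (Suc m) (N div 2 - 1)"
      and same: "\<forall>p. (\<forall>i\<ge>Suc m. p \<noteq> 5 * i + j) \<longrightarrow> tp' p = ?tp p"
      by blast
    have "tp' (5 * m + j) = True" using same by simp
    moreover have "(N - 1) div 2 = N div 2 - 1" "odd (N - 1)" using False Suc.prems(2) by presburger+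
    ultimately have "num tp' j m (N - 1)" using n' by (subst num_step) simp
    moreover have "exec W x (carry False) (f, h, tp, 5 * m + j, ou) (f, h, tp', 5 * e + j, ou)"
      using b(1) False Suc.prems(4) by (intro exec_carry_go[OF _ _ 1]) simp_all
    moreover have "\<forall>p. (\<forall>i\<ge>m. p \<noteq> 5 * i + j) \<longrightarrow> tp' p = tp p" using same by auto
    ultimately show ?thesis using e by (intro exI[of _ e] exI[of _ tp']) auto
  qed
qed simp

text \<open>The two strides add up to five: \<open>j + 1\<close> cells from track 1 to track
  \<open>j + 2\<close>, then \<open>4 - j\<close> cells to track 1 of the next block. The flag ends
  the loop at the first one found and is also the answer.\<close>

definition scan :: "nat \<Rightarrow> com" where
  "scan j = While (\<lambda>_ b f. b \<and> \<not> f) (works R (j + 1) ;; get_flag ;; works R (4 - j))"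

lemma exec_scan:
  assumes "num tp (j + 2) m N" "\<forall>i. tp (5 * i + 1) = (i < m + d)" "N < 2 ^ d" "5 * (m + d) + 1 \<le> W" "j < 3"
  shows "\<exists>e\<le>m + d. exec W x (scan j) (False, h, tp, 5 * m + 1, ou) (N \<noteq> 0, h, tp, 5 * e + 1, ou)"
  using assms
proof (induction d arbitrary: m N)
  case 0
  then have "\<not> tp (5 * m + 1)" "N = 0" by auto
  then show ?case unfolding scan_def by (intro exI[of _ m]) (auto intro: exec_WhileF)
next
  case (Suc d)
  let ?s = "(odd N, h, tp, 5 * Suc m + 1, ou)"
  from Suc.prems(1) have b: "tp (5 * m + (j + 2)) = odd N" "num tp (j + 2) (Suc m) (N div 2)"
    by (simp_all add: num_step[of tp _ m])
  have 1: "exec W x (works R (j + 1)) (False, h, tp, 5 * m + 1, ou) (False, h, tp, 5 * m + (j + 2), ou)"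
    using exec_right[of "5 * m + 1" "j + 1" W] Suc.prems(4,5) by (simp add: add_ac)
  have 2: "exec W x get_flag (False, h, tp, 5 * m + (j + 2), ou) (odd N, h, tp, 5 * m + (j + 2), ou)"
    using exec_get_flag[of "5 * m + (j + 2)" W x False h tp ou] b(1) Suc.prems(4,5) by simp
  have "5 * m + (j + 2) + (4 - j) = 5 * Suc m + 1" using Suc.prems(5) by simp
  then have 3: "exec W x (works R (4 - j)) (odd N, h, tp, 5 * m + (j + 2), ou) ?s"
    using exec_right[of "5 * m + (j + 2)" "4 - j" W x "odd N" h tp ou] Suc.prems(4) by simp
  have t: "tp (5 * m + 1)" using Suc.prems(2) by simp
  note go = exec_WhileT[of "\<lambda>_ b f. b \<and> \<not> f" x h tp "5 * m + 1" False, OF _ exec_Seq[OF 1 exec_Seq[OF 2 3]], folded scan_def]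
  show ?case
  proof (cases "odd N")
    case True
    have "exec W x (scan j) ?s ?s" unfolding scan_def by (rule exec_WhileF) (simp add: True)
    from go[OF _ this] t True show ?thesis
      by (intro exI[of _ "Suc m"]) (auto elim: oddE)
  next
    case False
    have "\<forall>i. tp (5 * i + 1) = (i < Suc m + d)" "N div 2 < 2 ^ d" using Suc.prems(2,3) by auto
    from Suc.IH[OF b(2) this] Suc.prems obtain e where e: "e \<le> Suc m + d"
      "exec W x (scan j) (False, h, tp, 5 * Suc m + 1, ou) (N div 2 \<noteq> 0, h, tp, 5 * e + 1, ou)" by auto
    have "(N div 2 \<noteq> 0) = (N \<noteq> 0)" using False by auto
    with go e t False show ?thesis by (intro exI[of _ e]) auto
  qed
qed

text \<open>Five interleaved tracks: cell \<open>5 * m + i\<close> belongs to track \<open>i\<close>. Track 0 marks the left end of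
  the tape, track 1 the blocks in use (so that a zero test knows where to stop), and tracks 2 to 4 hold
  the counters with least significant bit first.\<close>

definition rep :: "nat \<Rightarrow> (nat \<Rightarrow> nat) \<Rightarrow> (nat \<Rightarrow> bool) \<Rightarrow> bool" where
  "rep u v tp \<longleftrightarrow> tp 0 \<and> (\<forall>m>0. \<not> tp (5 * m)) \<and> (\<forall>m. tp (5 * m + 1) = (m < u)) \<and>
     (\<forall>j<3. num tp (j + 2) 0 (v j) \<and> v j < 2 ^ u)"

lemma track_neq: "j < 5 \<Longrightarrow> j' < 5 \<Longrightarrow> j \<noteq> j' \<Longrightarrow> 5 * m + j \<noteq> 5 * m' + (j' :: nat)"
  by presburger

text \<open>A frame rule: outside track \<open>j + 2\<close> and the marks of track 1 nothing
  changes, so the other counters survive, and their bounds do because \<open>u\<close> can only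
  grow.\<close>

lemma rep_update:
  assumes r: "rep u v tp" and j: "j < 3" and n: "num tp' (j + 2) 0 N" and N: "N < 2 ^ u'" and u: "u \<le> u'"
    and used: "\<forall>m. tp' (5 * m + 1) = (m < u')"
    and same: "\<And>m i. i < 5 \<Longrightarrow> i \<noteq> j + 2 \<Longrightarrow> i \<noteq> 1 \<Longrightarrow> tp' (5 * m + i) = tp (5 * m + i)"
  shows "rep u' (v(j := N)) tp'"
  unfolding rep_def
proof (intro conjI allI impI)
  show "tp' 0" using same[of 0 0] r by (simp add: rep_def)
  show "\<not> tp' (5 * m)" if "0 < m" for m using same[of 0 m] r that by (simp add: rep_def)
  show "tp' (5 * m + 1) = (m < u')" for m using used by simp
  fix i :: nat assume i: "i < 3"
  show "num tp' (i + 2) 0 ((v(j := N)) i)"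
  proof (cases "i = j")
    case False
    then show ?thesis
      using r i same[of "i + 2"] num_cong[of 0 tp "i + 2" tp' "v i"] by (simp add: rep_def)
  qed (use n in simp)
  have "(2::nat) ^ u \<le> 2 ^ u'" using u by simp
  then show "(v(j := N)) i < 2 ^ u'" using r i N by (auto simp: rep_def intro: less_le_trans)
qed

text \<open>The carry may stop in the first block not yet in use, so the mark of the stopping block
  is set on the way home.\<close>

definition inc :: "nat \<Rightarrow> com" where
  "inc j = works R (j + 2) ;; carry True ;; works L (j + 1) ;; put_bit True ;; works L 1 ;; home"
definition dec :: "nat \<Rightarrow> com" where
  "dec j = works R (j + 2) ;; carry False ;; works L (j + 2) ;; home"
definition nonzero :: "nat \<Rightarrow> com" where
  "nonzero j = clear_flag ;; works R 1 ;; scan j ;; works L 1 ;; home"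

text \<open>A block is opened only when the counter reaches exactly \<open>2 ^ u\<close>, so the new
  \<open>2 ^ u'\<close> is twice a value that a counter has attained. This keeps the tape
  logarithmic although blocks are never released.\<close>

lemma exec_inc:
  assumes r: "rep u v tp" and j: "j < 3" and W: "5 * u + 10 \<le> W"
  shows "\<exists>u' tp'. exec W x (inc j) (f, h, tp, 0, ou) (f, h, tp', 0, ou) \<and>
    rep u' (v(j := v j + 1)) tp' \<and> (u' = u \<or> u' = Suc u \<and> v j + 1 = 2 ^ u)"
proof -
  have "num tp (j + 2) 0 (v j)" "v j < 2 ^ u" using r j by (auto simp: rep_def)
  from exec_carry_inc[OF this, of W x f h ou] j W obtain e tp1 where
    1: "exec W x (carry True) (f, h, tp, j + 2, ou) (f, h, tp1, 5 * e + (j + 2), ou)"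
    and e: "e \<le> u" "if e = u then v j + 1 = 2 ^ u else v j + 1 < 2 ^ u"
    and n: "num tp1 (j + 2) 0 (v j + 1)"
    and same: "\<forall>p. (\<forall>i. p \<noteq> 5 * i + (j + 2)) \<longrightarrow> tp1 p = tp p" by auto
  define tp2 where "tp2 = tp1(5 * e + 1 := True)"
  have same1: "tp1 (5 * m + i) = tp (5 * m + i)" if "i < 5" "i \<noteq> j + 2" for m i
    using same track_neq[of i "j + 2" m] that j by simp
  have same2: "tp2 (5 * m + i) = tp1 (5 * m + i)" if "i < 5" "i \<noteq> 1" for m i
    using track_neq[of i 1 m e] that by (auto simp: tp2_def)
  define u' where "u' = max u (Suc e)"
  have r': "rep u' (v(j := v j + 1)) tp2"
  proof (rule rep_update[OF r j])
    show "num tp2 (j + 2) 0 (v j + 1)"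
      using n num_cong[of 0 tp1 "j + 2" tp2 "v j + 1"] same2[of "j + 2"] j by simp
    show "v j + 1 < 2 ^ u'" using e power_strict_increasing_iff[of "2::nat" u "Suc e"]
      by (cases "e = u") (auto simp: u'_def max_absorb1)
    show "u \<le> u'" by (simp add: u'_def)
    show "\<forall>m. tp2 (5 * m + 1) = (m < u')"
      using same1[of 1] r j e by (auto simp: tp2_def rep_def u'_def)
    show "tp2 (5 * m + i) = tp (5 * m + i)" if "i < 5" "i \<noteq> j + 2" "i \<noteq> 1" for m i
      using same1 same2 that by simp
  qed
  have ex: "exec W x (inc j) (f, h, tp, 0, ou) (f, h, tp2, 0, ou)"
    unfolding inc_def
  proof (intro exec_Seq)
    show "exec W x (works R (j + 2)) (f, h, tp, 0, ou) (f, h, tp, j + 2, ou)"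
      using exec_right[of 0 "j + 2" W] W j by simp
    show "exec W x (carry True) (f, h, tp, j + 2, ou) (f, h, tp1, 5 * e + (j + 2), ou)" by (rule 1)
    show "exec W x (works L (j + 1)) (f, h, tp1, 5 * e + (j + 2), ou) (f, h, tp1, 5 * e + 1, ou)"
      using exec_left[of "5 * e + 1" "j + 1" W x f h tp1 ou] W j e by (simp add: add_ac)
    show "exec W x (put_bit True) (f, h, tp1, 5 * e + 1, ou) (f, h, tp2, 5 * e + 1, ou)"
      using exec_put_bit[of "5 * e + 1" W] W e by (simp add: tp2_def)
    show "exec W x (works L 1) (f, h, tp2, 5 * e + 1, ou) (f, h, tp2, 5 * e, ou)"
      using exec_left[of "5 * e" 1 W] W e by simp
    show "exec W x home (f, h, tp2, 5 * e, ou) (f, h, tp2, 0, ou)"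
      using exec_home[of tp2 e W] r' W e by (simp add: rep_def)
  qed
  show ?thesis using ex r' e by (intro exI[of _ u'] exI[of _ tp2]) (auto simp: u'_def max_def split: if_splits)
qed

lemma exec_dec:
  assumes r: "rep u v tp" and j: "j < 3" and W: "5 * u + 10 \<le> W" and pos: "0 < v j"
  shows "\<exists>tp'. exec W x (dec j) (f, h, tp, 0, ou) (f, h, tp', 0, ou) \<and> rep u (v(j := v j - 1)) tp'"
proof -
  have "num tp (j + 2) 0 (v j)" "v j < 2 ^ u" using r j by (auto simp: rep_def)
  from exec_carry_dec[OF this(1) pos this(2), of W x f h ou] j W obtain e tp1 where
    1: "exec W x (carry False) (f, h, tp, j + 2, ou) (f, h, tp1, 5 * e + (j + 2), ou)"
    and e: "e < u" and n: "num tp1 (j + 2) 0 (v j - 1)"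
    and same: "\<forall>p. (\<forall>i. p \<noteq> 5 * i + (j + 2)) \<longrightarrow> tp1 p = tp p" by auto
  have same1: "tp1 (5 * m + i) = tp (5 * m + i)" if "i < 5" "i \<noteq> j + 2" for m i
    using same track_neq[of i "j + 2" m] that j by simp
  have r': "rep u (v(j := v j - 1)) tp1"
    by (rule rep_update[OF r j n]) (use same1[of 1] same1 r j in \<open>auto simp: rep_def intro: less_imp_diff_less\<close>)
  have "exec W x (dec j) (f, h, tp, 0, ou) (f, h, tp1, 0, ou)"
    unfolding dec_def
  proof (intro exec_Seq)
    show "exec W x (works R (j + 2)) (f, h, tp, 0, ou) (f, h, tp, j + 2, ou)"
      using exec_right[of 0 "j + 2" W] W j by simp
    show "exec W x (carry False) (f, h, tp, j + 2, ou) (f, h, tp1, 5 * e + (j + 2), ou)" by (rule 1)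
    show "exec W x (works L (j + 2)) (f, h, tp1, 5 * e + (j + 2), ou) (f, h, tp1, 5 * e, ou)"
      using exec_left[of "5 * e" "j + 2" W] W j e by simp
    show "exec W x home (f, h, tp1, 5 * e, ou) (f, h, tp1, 0, ou)"
      using exec_home[of tp1 e W] r' W e by (simp add: rep_def)
  qed
  with r' show ?thesis by blast
qed

lemma exec_nonzero:
  assumes r: "rep u v tp" and j: "j < 3" and W: "5 * u + 10 \<le> W"
  shows "exec W x (nonzero j) (f, h, tp, 0, ou) (v j \<noteq> 0, h, tp, 0, ou)"
proof -
  have "num tp (j + 2) 0 (v j)" "v j < 2 ^ u" "\<forall>i. tp (5 * i + 1) = (i < 0 + u)"
    using r j by (auto simp: rep_def)
  from exec_scan[OF this(1,3,2), of W x h ou] j W obtain e where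
    1: "exec W x (scan j) (False, h, tp, 1, ou) (v j \<noteq> 0, h, tp, 5 * e + 1, ou)" and e: "e \<le> u"
    by auto
  show ?thesis unfolding nonzero_def
  proof (intro exec_Seq)
    show "exec W x clear_flag (f, h, tp, 0, ou) (False, h, tp, 0, ou)" by (simp add: exec_clear_flag)
    show "exec W x (works R 1) (False, h, tp, 0, ou) (False, h, tp, 1, ou)"
      using exec_right[of 0 1 W] W by simp
    show "exec W x (scan j) (False, h, tp, 1, ou) (v j \<noteq> 0, h, tp, 5 * e + 1, ou)" by (rule 1)
    show "exec W x (works L 1) (v j \<noteq> 0, h, tp, 5 * e + 1, ou) (v j \<noteq> 0, h, tp, 5 * e, ou)"
      using exec_left[of "5 * e" 1 W] W e by simp
    show "exec W x home (v j \<noteq> 0, h, tp, 5 * e, ou) (v j \<noteq> 0, h, tp, 0, ou)"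
      using exec_home[of tp e W] r W e by (simp add: rep_def)
  qed
qed

section \<open>The clauses and their proof-theoretic meaning\<close>

lemma nd_weaken: "nd G A \<Longrightarrow> G \<subseteq> H \<Longrightarrow> nd H A"
proof (induction arbitrary: H rule: nd.induct)
  case (Assm A G)
  then show ?case by (blast intro: nd.Assm)
next
  case (ImpI A G B)
  then show ?case by (meson nd.ImpI insert_mono)
next
  case (ImpE G A B)
  then show ?case by (meson nd.ImpE)
next
  case (ConjE1 G A B)
  then show ?case by (meson nd.ConjE1)
next
  case (ConjE2 G A B)
  then show ?case by (meson nd.ConjE2)
next
  case (DisjE G A B C)
  then show ?case by (meson nd.DisjE insert_mono)
next
  case (BotE G A)
  then show ?case by (meson nd.BotE)
qed (simp_all add: nd.ConjI nd.DisjI1 nd.DisjI2)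

fun subst :: "(nat \<Rightarrow> form) \<Rightarrow> form \<Rightarrow> form" where
  "subst \<sigma> (Var n) = \<sigma> n"
| "subst \<sigma> Bot = Bot"
| "subst \<sigma> (Imp A B) = Imp (subst \<sigma> A) (subst \<sigma> B)"
| "subst \<sigma> (Conj A B) = Conj (subst \<sigma> A) (subst \<sigma> B)"
| "subst \<sigma> (Disj A B) = Disj (subst \<sigma> A) (subst \<sigma> B)"

lemma nd_subst: "nd G A \<Longrightarrow> nd (subst \<sigma> ` G) (subst \<sigma> A)"
proof (induction rule: nd.induct)
  case (ImpE G A B)
  then show ?case by (metis nd.ImpE subst.simps(3))
next
  case (ConjE1 G A B)
  then show ?case by (metis nd.ConjE1 subst.simps(4))
next
  case (ConjE2 G A B)
  then show ?case by (metis nd.ConjE2 subst.simps(4))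
next
  case (DisjE G A B C)
  show ?case by (rule nd.DisjE[of _ "subst \<sigma> A" "subst \<sigma> B"]) (use DisjE.IH in simp_all)
next
  case (BotE G A)
  then show ?case by (metis nd.BotE subst.simps(2))
qed (simp_all add: nd.Assm nd.ImpI nd.ConjI nd.DisjI1 nd.DisjI2)

lemma nd_id: "nd G (Imp A A)"
  by (rule ImpI, rule Assm) simp

lemma nd_cut: "nd G A \<Longrightarrow> nd (insert A G) B \<Longrightarrow> nd G B"
  by (meson ImpE ImpI)

text \<open>The deduction theorem, iterated: provability of the translation becomes derivability of
  the root atom from the clauses.\<close>

lemma nd_imps: "nd G (foldr Imp Cs A) \<longleftrightarrow> nd (set Cs \<union> G) A"
proof (induction Cs arbitrary: G)
  case (Cons C Cs)
  have "nd G (Imp C D) \<longleftrightarrow> nd (insert C G) D" for D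
    by (meson Assm ImpE ImpI insertI1 nd_weaken subset_insertI)
  with Cons[of "insert C G"] show ?case by simp
qed simp

lemma nd_cuts: "\<forall>C\<in>set Cs. nd {} C \<Longrightarrow> nd (set Cs) A \<Longrightarrow> nd {} A"
proof (induction Cs)
  case (Cons C Cs)
  then have "nd (set Cs) C" "nd (insert C (set Cs)) A" using nd_weaken[of "{}" C "set Cs"] by auto
  with Cons nd_cut show ?case by auto
qed simp

section \<open>Names for positions and variables, and the clauses\<close>

declare bin.simps [simp del]

abbreviation vpos :: "nat \<Rightarrow> form" where "vpos i \<equiv> Var (2 ^ i)"

text \<open>The binary code of \<open>xcode k\<close> is that of \<open>k\<close> preceded by two ones, so a transducer can copy it from the
  input, and it is never a power of two.\<close>

definition xcode :: "nat \<Rightarrow> nat" where "xcode k = 3 * 2 ^ length (bin k) + k"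
abbreviation vext :: "nat \<Rightarrow> form" where "vext k \<equiv> Var (xcode k)"

lemma bin_rec: "n \<ge> 2 \<Longrightarrow> bin n = bin (n div 2) @ [if even n then SZero else SOne]"
  by (subst bin.simps) (simp add: even_iff_mod_2_eq_zero)

lemma bin_0 [simp]: "bin 0 = [SZero]" and bin_1 [simp]: "bin (Suc 0) = [SOne]"
  by (subst bin.simps, simp)+

lemma bin_pow2: "bin (2 ^ i) = SOne # replicate i SZero"
proof (induction i)
  case (Suc i)
  have "bin (2 ^ Suc i) = bin (2 ^ i) @ [SZero]" using bin_rec[of "2 ^ Suc i"] by simp
  with Suc show ?case by (simp add: replicate_append_same)
qed simp

lemma bin_xcode: "bin (xcode k) = SOne # SOne # bin k"
proof (induction k rule: less_induct)
  case (less k)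
  show ?case
  proof (cases "k < 2")
    case True
    then have "k = 0 \<or> k = 1" by auto
    then show ?thesis by (auto simp: xcode_def bin_rec)
  next
    case False
    then have b: "bin k = bin (k div 2) @ [if even k then SZero else SOne]" by (simp add: bin_rec)
    have "xcode k div 2 = xcode (k div 2)" "even (xcode k) = even k" "xcode k \<ge> 2"
      using False by (simp_all add: xcode_def b)
    then have "bin (xcode k) = bin (xcode (k div 2)) @ [if even k then SZero else SOne]"
      by (simp add: bin_rec)
    with less[of "k div 2"] False b show ?thesis by simp
  qed
qed

text \<open>The length of the code separates 0 and 1 from larger numbers; for the latter the last
  bit gives the parity and the other bits the half.\<close>

lemma bin_inj: "bin m = bin n \<Longrightarrow> m = n"
proof (induction m arbitrary: n rule: less_induct)
  case (less m)
  have ne: "bin k \<noteq> []" for k by (subst bin.simps) simp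
  have l: "length (bin k) = 1 \<longleftrightarrow> k < 2" for k
    by (subst bin.simps) (simp add: ne)
  show ?case
  proof (cases "m < 2")
    case True
    then have "n < 2" using l less.prems by metis
    with True less.prems show ?thesis by (auto simp: less_2_cases_iff)
  next
    case False
    then have "n \<ge> 2" using l less.prems by (metis not_le)
    with False less.prems have "bin (m div 2) = bin (n div 2)" "even m = even n"
      by (auto simp: bin_rec split: if_splits)
    with less.IH[of "m div 2" "n div 2"] False have "m div 2 = n div 2" by simp
    with \<open>even m = even n\<close> show ?thesis by (metis even_iff_mod_2_eq_zero div_mult_mod_eq not_mod_2_eq_0_eq_1)
  qed
qed

lemma xcode_inj: "inj xcode"
  by (metis bin_inj bin_xcode injI list.inject)

text \<open>After its leading one, the code of a power of two has only zeros, while the code of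
  \<open>xcode k\<close> continues with a second one.\<close>

lemma xcode_neq_pow2: "xcode k \<noteq> 2 ^ i"
  by (metis bin_pow2 bin_xcode list.inject list.sel(1) list.set_intros(1) in_set_replicate sym.distinct(15))

text \<open>The largest order, two, occurs in the clause from
  \<open>p\<^sub>a \<to> p\<^sub>b\<close> to \<open>p\<^sub>i\<close> and in the eliminations of
  disjunctions. The targets \<open>r\<close> run over all cells 0 to \<open>n\<close> of the input
  and not just over nodes, so that the input head can enumerate them without any test.\<close>

fun clauses :: "nat \<Rightarrow> nat \<Rightarrow> form \<Rightarrow> form list" where
  "clauses n i (Var k) = [Imp (vpos i) (vext k), Imp (vext k) (vpos i)]"
| "clauses n i Bot = map (\<lambda>r. Imp (vpos i) (vpos r)) [0..<Suc n]"
| "clauses n i (Imp A B) = (let j = i + 1 + length (enc A) in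
    [Imp (vpos i) (Imp (vpos (i + 1)) (vpos j)), Imp (Imp (vpos (i + 1)) (vpos j)) (vpos i)]
    @ clauses n (i + 1) A @ clauses n j B)"
| "clauses n i (Conj A B) = (let j = i + 1 + length (enc A) in
    [Imp (vpos i) (vpos (i + 1)), Imp (vpos i) (vpos j), Imp (vpos (i + 1)) (Imp (vpos j) (vpos i))]
    @ clauses n (i + 1) A @ clauses n j B)"
| "clauses n i (Disj A B) = (let j = i + 1 + length (enc A) in
    [Imp (vpos (i + 1)) (vpos i), Imp (vpos j) (vpos i)]
    @ map (\<lambda>r. Imp (vpos i) (Imp (Imp (vpos (i + 1)) (vpos r)) (Imp (Imp (vpos j) (vpos r)) (vpos r)))) [0..<Suc n]
    @ clauses n (i + 1) A @ clauses n j B)"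

text \<open>Positions start at 1 to agree with the cells of the input tape, whose cell 0 holds the
  left end marker.\<close>

definition transl :: "form \<Rightarrow> form" where
  "transl \<phi> = foldr Imp (clauses (length (enc \<phi>)) 1 \<phi>) (vpos 1)"

lemma clauses_shape: "C \<in> set (clauses n i A) \<Longrightarrow> implicational C \<and> order C \<le> 2"
  by (induction n i A rule: clauses.induct) (auto simp: Let_def)

lemma transl_shape: "implicational (transl \<phi>) \<and> order (transl \<phi>) \<le> 3"
proof -
  have "(\<forall>C\<in>set Cs. implicational C \<and> order C \<le> 2) \<Longrightarrow>
      implicational (foldr Imp Cs (vpos 1)) \<and> order (foldr Imp Cs (vpos 1)) \<le> 3" for Cs
    by (induction Cs) auto
  then show ?thesis unfolding transl_def using clauses_shape by blast
qed

section \<open>Soundness: naming back the subformulas\<close>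

fun subform_at :: "nat \<Rightarrow> form \<Rightarrow> nat \<Rightarrow> form" where
  "subform_at i (Imp A B) p = (if p = i then Imp A B
     else if p < i + 1 + length (enc A) then subform_at (i + 1) A p
     else subform_at (i + 1 + length (enc A)) B p)"
| "subform_at i (Conj A B) p = (if p = i then Conj A B
     else if p < i + 1 + length (enc A) then subform_at (i + 1) A p
     else subform_at (i + 1 + length (enc A)) B p)"
| "subform_at i (Disj A B) p = (if p = i then Disj A B
     else if p < i + 1 + length (enc A) then subform_at (i + 1) A p
     else subform_at (i + 1 + length (enc A)) B p)"
| "subform_at i A p = A"

lemma enc_pos: "0 < length (enc A)" by (cases A) auto

lemma subform_at_root [simp]: "subform_at i A i = A" by (cases A) auto

text \<open>Once each name stands for its subformula, every clause is an instance of an introduction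
  or elimination rule. Targets \<open>r\<close> at cells that are not nodes do no harm, since
  falsity and disjunction can be eliminated into any formula. The condition on
  \<open>\<sigma>\<close> is limited to the cells of the occurrence so that it splits along the
  induction.\<close>

lemma clauses_valid:
  assumes "\<forall>p. i \<le> p \<and> p < i + length (enc A) \<longrightarrow> \<sigma> (2 ^ p) = subform_at i A p"
    and "\<forall>k. \<sigma> (xcode k) = Var k" and "C \<in> set (clauses n i A)"
  shows "nd {} (subst \<sigma> C)"
  using assms
proof (induction n i A rule: clauses.induct)
  case (1 n i k)
  have "\<sigma> (2 ^ i) = Var k" using 1(1)[rule_format, of i] by simp
  with 1(2,3) nd_id show ?case by auto
next
  case (2 n i)
  then have "\<sigma> (2 ^ i) = Bot" by auto
  moreover have "nd {} (Imp Bot D)" for D by (rule ImpI, rule BotE, rule Assm) simp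
  ultimately show ?case using 2 by auto
next
  case (3 n i A B)
  let ?j = "i + 1 + length (enc A)"
  have s: "\<sigma> (2 ^ i) = Imp A B" "\<sigma> (2 ^ (i + 1)) = A" "\<sigma> (2 ^ ?j) = B"
    using 3(3)[rule_format, of i] 3(3)[rule_format, of "i + 1"] 3(3)[rule_format, of ?j]
      enc_pos[of A] enc_pos[of B] by (simp_all del: power_Suc)
  have a: "\<forall>p. i + 1 \<le> p \<and> p < i + 1 + length (enc A) \<longrightarrow> \<sigma> (2 ^ p) = subform_at (i + 1) A p"
    and b: "\<forall>p. ?j \<le> p \<and> p < ?j + length (enc B) \<longrightarrow> \<sigma> (2 ^ p) = subform_at ?j B p"
    using 3(3) by auto
  consider "C = Imp (vpos i) (Imp (vpos (i + 1)) (vpos ?j))" | "C = Imp (Imp (vpos (i + 1)) (vpos ?j)) (vpos i)"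
    | "C \<in> set (clauses n (i + 1) A)" | "C \<in> set (clauses n ?j B)"
    using 3(5) by (auto simp: Let_def)
  then show ?case
  proof cases
    case 3
    then show ?thesis using "3.IH"(1)[OF refl a] "3.prems" by blast
  next
    case 4
    then show ?thesis using "3.IH"(2)[OF refl b] "3.prems" by blast
  qed (simp_all only: s subst.simps nd_id)
next
  case (4 n i A B)
  let ?j = "i + 1 + length (enc A)"
  have s: "\<sigma> (2 ^ i) = Conj A B" "\<sigma> (2 ^ (i + 1)) = A" "\<sigma> (2 ^ ?j) = B"
    using 4(3)[rule_format, of i] 4(3)[rule_format, of "i + 1"] 4(3)[rule_format, of ?j]
      enc_pos[of A] enc_pos[of B] by (simp_all del: power_Suc)
  have a: "\<forall>p. i + 1 \<le> p \<and> p < i + 1 + length (enc A) \<longrightarrow> \<sigma> (2 ^ p) = subform_at (i + 1) A p"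
    and b: "\<forall>p. ?j \<le> p \<and> p < ?j + length (enc B) \<longrightarrow> \<sigma> (2 ^ p) = subform_at ?j B p"
    using 4(3) by auto
  consider "C = Imp (vpos i) (vpos (i + 1))" | "C = Imp (vpos i) (vpos ?j)"
    | "C = Imp (vpos (i + 1)) (Imp (vpos ?j) (vpos i))"
    | "C \<in> set (clauses n (i + 1) A)" | "C \<in> set (clauses n ?j B)"
    using 4(5) by (auto simp: Let_def)
  then show ?case
  proof cases
    case 4
    then show ?thesis using "4.IH"(1)[OF refl a] "4.prems" by blast
  next
    case 5
    then show ?thesis using "4.IH"(2)[OF refl b] "4.prems" by blast
  next
    case 1
    moreover have "nd {} (Imp (Conj A B) A)" by (rule ImpI, rule ConjE1, rule Assm) simp
    ultimately show ?thesis by (simp only: s subst.simps)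
  next
    case 2
    moreover have "nd {} (Imp (Conj A B) B)" by (rule ImpI, rule ConjE2, rule Assm) simp
    ultimately show ?thesis by (simp only: s subst.simps)
  next
    case 3
    then show ?thesis by (simp only: s subst.simps) (rule ImpI, rule ImpI, rule ConjI; rule Assm; simp)
  qed
next
  case (5 n i A B)
  let ?j = "i + 1 + length (enc A)"
  have s: "\<sigma> (2 ^ i) = Disj A B" "\<sigma> (2 ^ (i + 1)) = A" "\<sigma> (2 ^ ?j) = B"
    using 5(3)[rule_format, of i] 5(3)[rule_format, of "i + 1"] 5(3)[rule_format, of ?j]
      enc_pos[of A] enc_pos[of B] by (simp_all del: power_Suc)
  have a: "\<forall>p. i + 1 \<le> p \<and> p < i + 1 + length (enc A) \<longrightarrow> \<sigma> (2 ^ p) = subform_at (i + 1) A p"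
    and b: "\<forall>p. ?j \<le> p \<and> p < ?j + length (enc B) \<longrightarrow> \<sigma> (2 ^ p) = subform_at ?j B p"
    using 5(3) by auto
  consider "C = Imp (vpos (i + 1)) (vpos i)" | "C = Imp (vpos ?j) (vpos i)"
    | r where "C = Imp (vpos i) (Imp (Imp (vpos (i + 1)) (vpos r)) (Imp (Imp (vpos ?j) (vpos r)) (vpos r)))"
    | "C \<in> set (clauses n (i + 1) A)" | "C \<in> set (clauses n ?j B)"
    using 5(5) by (auto simp: Let_def)
  then show ?case
  proof cases
    case 4
    then show ?thesis using "5.IH"(1)[OF refl a] "5.prems" by blast
  next
    case 5
    then show ?thesis using "5.IH"(2)[OF refl b] "5.prems" by blast
  next
    case 1
    then show ?thesis by (simp only: s subst.simps) (rule ImpI, rule DisjI1, rule Assm, simp)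
  next
    case 2
    then show ?thesis by (simp only: s subst.simps) (rule ImpI, rule DisjI2, rule Assm, simp)
  next
    case (3 r)
    have "nd {} (Imp (Disj A B) (Imp (Imp A R) (Imp (Imp B R) R)))" for R
    proof (intro ImpI, rule DisjE[of _ A B])
      fix G show "nd (insert A (insert (Imp B R) (insert (Imp A R) (insert (Disj A B) G)))) R"
        by (rule ImpE[of _ A]) (auto intro!: Assm)
      show "nd (insert B (insert (Imp B R) (insert (Imp A R) (insert (Disj A B) G)))) R"
        by (rule ImpE[of _ B]) (auto intro!: Assm)
    qed (auto intro!: Assm)
    with 3 show ?thesis by (simp only: s subst.simps)
  qed
qed

lemma transl_sound:
  assumes "provable (transl \<phi>)" shows "provable \<phi>"
proof -
  let ?Cs = "clauses (length (enc \<phi>)) 1 \<phi>"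
  \<comment> \<open>Powers of two determine their exponents and no \<open>xcode k\<close> is one of
    them, so the two kinds of names are substituted independently, and \<open>vext k\<close> goes
    back to \<open>Var k\<close>.\<close>
  define \<sigma> where "\<sigma> m = (if \<exists>p. m = 2 ^ p then subform_at 1 \<phi> (THE p. m = 2 ^ p) else Var (inv xcode m))" for m
  have p: "\<sigma> (2 ^ p) = subform_at 1 \<phi> p" for p
    by (auto simp: \<sigma>_def)
  have x: "\<sigma> (xcode k) = Var k" for k
    by (auto simp: \<sigma>_def xcode_neq_pow2 xcode_inj)
  have "nd (set ?Cs) (vpos 1)" using assms nd_imps[of "{}"] by (simp add: provable_def transl_def)
  then have "nd (set (map (subst \<sigma>) ?Cs)) (subst \<sigma> (vpos 1))"
    using nd_subst by fastforce
  moreover have "subst \<sigma> (vpos 1) = \<phi>" using p[of 1] by simp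
  moreover have "\<forall>C\<in>set (map (subst \<sigma>) ?Cs). nd {} C"
    using clauses_valid[of 1 \<phi> \<sigma>] p x by auto
  ultimately show ?thesis using nd_cuts unfolding provable_def by metis
qed

section \<open>Completeness: a forcing model over sets of formulas\<close>

context
  fixes Cl :: "form set" and n :: nat
begin

text \<open>A variable of the given formula is read through the \<open>p\<^sub>r\<close> that the clauses make equivalent to it, so
  that elimination of a forced disjunction into any formula reduces to elimination into the \<open>p\<^sub>r\<close>; the
  worlds need not be prime.\<close>

fun forces :: "form set \<Rightarrow> form \<Rightarrow> bool" where
  "forces G (Var k) \<longleftrightarrow> (\<forall>r\<le>n. Imp (vext k) (vpos r) \<in> Cl \<longrightarrow> nd G (vpos r))"
| "forces G Bot \<longleftrightarrow> (\<forall>r\<le>n. nd G (vpos r))"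
| "forces G (Imp A B) \<longleftrightarrow> (\<forall>H. G \<subseteq> H \<longrightarrow> forces H A \<longrightarrow> forces H B)"
| "forces G (Conj A B) \<longleftrightarrow> forces G A \<and> forces G B"
| "forces G (Disj A B) \<longleftrightarrow> (\<forall>r\<le>n. \<forall>H. G \<subseteq> H \<longrightarrow>
     (\<forall>K. H \<subseteq> K \<longrightarrow> forces K A \<longrightarrow> nd K (vpos r)) \<longrightarrow>
     (\<forall>K. H \<subseteq> K \<longrightarrow> forces K B \<longrightarrow> nd K (vpos r)) \<longrightarrow> nd H (vpos r))"

lemma forces_mono: "forces G A \<Longrightarrow> G \<subseteq> H \<Longrightarrow> forces H A"
proof (induction A arbitrary: G H)
  case (Imp A B)
  then show ?case unfolding forces.simps(3) by (meson order_trans)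
next
  case (Disj A B)
  then show ?case unfolding forces.simps(5) by (meson order_trans)
qed (auto intro: nd_weaken)

text \<open>Forcing always ends in derivability of some \<open>vpos r\<close> with
  \<open>r \<le> n\<close>, and a world forcing \<open>Bot\<close> derives all of these, as do its
  extensions.\<close>

lemma forces_exfalso: "forces G Bot \<Longrightarrow> forces G C"
proof (induction C arbitrary: G)
  case (Imp C D)
  then show ?case by (meson forces.simps(3) forces_mono)
next
  case (Disj C D)
  then show ?case by (auto intro: nd_weaken)
qed simp_all

text \<open>By definition a forced disjunction may only be eliminated into atoms
  \<open>vpos r\<close>. Induction on \<open>C\<close> lifts this to all formulas:
  \<open>Var\<close> and \<open>Bot\<close> are forced through such atoms, an implication is handled
  by moving to an extension that forces its premise, and a conjunction componentwise.\<close>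

lemma forces_cases:
  assumes "forces G (Disj A B)" "\<forall>H. G \<subseteq> H \<longrightarrow> forces H A \<longrightarrow> forces H C"
    "\<forall>H. G \<subseteq> H \<longrightarrow> forces H B \<longrightarrow> forces H C"
  shows "forces G C"
  using assms
proof (induction C arbitrary: G)
  case (Var k)
  show ?case unfolding forces.simps(1)
  proof (intro allI impI)
    fix r assume "r \<le> n" "Imp (vext k) (vpos r) \<in> Cl"
    with Var show "nd G (vpos r)" unfolding forces.simps(1,5) by blast
  qed
next
  case Bot
  then show ?case unfolding forces.simps(2,5) by blast
next
  case (Imp C D)
  show ?case unfolding forces.simps(3)
  proof (intro allI impI)
    fix H assume H: "G \<subseteq> H" "forces H C"
    show "forces H D"
    proof (rule Imp.IH(2))
      show "forces H (Disj A B)" using Imp.prems(1) H(1) forces_mono by blast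
      show "\<forall>K. H \<subseteq> K \<longrightarrow> forces K A \<longrightarrow> forces K D"
        using Imp.prems(2) H forces_mono by (meson forces.simps(3) order_refl order_trans)
      show "\<forall>K. H \<subseteq> K \<longrightarrow> forces K B \<longrightarrow> forces K D"
        using Imp.prems(3) H forces_mono by (meson forces.simps(3) order_refl order_trans)
    qed
  qed
next
  case (Conj C D)
  then show ?case unfolding forces.simps(4) by blast
next
  case (Disj C D)
  show ?case unfolding forces.simps(5)[of G C D]
  proof (intro allI impI)
    fix r H assume H: "r \<le> n" "G \<subseteq> H"
      "\<forall>K. H \<subseteq> K \<longrightarrow> forces K C \<longrightarrow> nd K (vpos r)" "\<forall>K. H \<subseteq> K \<longrightarrow> forces K D \<longrightarrow> nd K (vpos r)"
    \<comment> \<open>Two case analyses are composed: the target disjunction is itself eliminated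
      into \<open>vpos r\<close>, so either branch of the given disjunction leads to
      \<open>vpos r\<close>, an admissible target.\<close>
    have "nd K (vpos r)" if "H \<subseteq> K" "forces K (Disj C D)" for K
      using that H unfolding forces.simps(5) by (meson order_refl order_trans)
    then show "nd H (vpos r)" using Disj.prems H(1,2) unfolding forces.simps(5)[of G A B]
      by (meson order_trans)
  qed
qed

lemma forces_nd: "nd Gam A \<Longrightarrow> \<forall>B\<in>Gam. forces G B \<Longrightarrow> forces G A"
proof (induction arbitrary: G rule: nd.induct)
  case (ImpI A Gam B)
  then show ?case unfolding forces.simps(3) by (metis forces_mono insert_iff)
next
  case (ImpE Gam A B)
  then show ?case unfolding forces.simps(3) by blast
next
  case (DisjE Gam A B C)
  show ?case
  proof (rule forces_cases)
    show "forces G (Disj A B)" using DisjE by blast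
    show "\<forall>H. G \<subseteq> H \<longrightarrow> forces H A \<longrightarrow> forces H C" "\<forall>H. G \<subseteq> H \<longrightarrow> forces H B \<longrightarrow> forces H C"
      using DisjE.IH(2,3) DisjE.prems forces_mono by (metis insert_iff)+
  qed
next
  case (DisjI1 Gam A B)
  then show ?case unfolding forces.simps(5) by (meson forces_mono order_refl)
next
  case (DisjI2 Gam B A)
  then show ?case unfolding forces.simps(5) by (meson forces_mono order_refl)
next
  case (BotE Gam A)
  then show ?case using forces_exfalso by blast
qed simp_all

lemma nd_mp: "Imp A B \<in> G \<Longrightarrow> nd G A \<Longrightarrow> nd G B"
  by (meson Assm ImpE)

text \<open>The truth lemma. The introduction clauses turn forcing into derivability, the
  elimination clauses the reverse. The length condition ensures \<open>i \<le> n\<close>, so the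
  name of the node is itself among the admissible targets.\<close>

lemma forces_iff_nd:
  assumes "set (clauses n i A) \<subseteq> Cl" "Cl \<subseteq> G" "i + length (enc A) \<le> Suc n"
  shows "forces G A \<longleftrightarrow> nd G (vpos i)"
  using assms
proof (induction A arbitrary: G i)
  case (Var k)
  \<comment> \<open>From \<open>vpos i\<close> one reaches \<open>vext k\<close> and then the atom
    of every occurrence of the variable; conversely \<open>r = i\<close> is one of the instances in
    the definition of forcing.\<close>
  then have "Imp (vpos i) (vext k) \<in> G" "Imp (vext k) (vpos i) \<in> Cl" "i \<le> n" by auto
  with Var.prems(2) nd_mp show ?case by (auto simp del: One_nat_def)
next
  case Bot
  then have "i \<le> n" and "\<forall>r\<le>n. Imp (vpos i) (vpos r) \<in> Cl"
    by (auto simp: image_subset_iff simp del: upt_Suc)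
  with Bot.prems(2) have "\<forall>r\<le>n. Imp (vpos i) (vpos r) \<in> G" "i \<le> n" by blast+
  with nd_mp show ?case by (auto simp del: One_nat_def)
next
  case (Imp A B)
  let ?j = "i + 1 + length (enc A)"
  have c: "Imp (vpos i) (Imp (vpos (i + 1)) (vpos ?j)) \<in> Cl" "Imp (Imp (vpos (i + 1)) (vpos ?j)) (vpos i) \<in> Cl"
    using Imp.prems(1) by (simp_all add: Let_def)
  have A: "forces H A \<longleftrightarrow> nd H (vpos (i + 1))" and B: "forces H B \<longleftrightarrow> nd H (vpos ?j)" if "Cl \<subseteq> H" for H
    using Imp.IH(1)[of "i + 1" H] Imp.IH(2)[of ?j H] Imp.prems that by (simp_all add: Let_def)
  show ?case
  proof
    assume f: "forces G (Imp A B)"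
    \<comment> \<open>Worlds are arbitrary extensions of the clauses, so assuming the name of
      \<open>A\<close> gives a world again, and by induction one that forces
      \<open>A\<close>.\<close>
    let ?H = "insert (vpos (i + 1)) G"
    have "nd ?H (vpos ?j)" using f A[of ?H] B[of ?H] Imp.prems(2) unfolding forces.simps(3)
      by (meson Assm insertI1 subset_insertI subset_insertI2)
    then have "nd G (Imp (vpos (i + 1)) (vpos ?j))" by (rule ImpI)
    then show "nd G (vpos i)" using c(2) Imp.prems(2) nd_mp by blast
  next
    assume p: "nd G (vpos i)"
    show "forces G (Imp A B)" unfolding forces.simps(3)
    proof (intro allI impI)
      fix H assume H: "G \<subseteq> H" "forces H A"
      have "nd H (vpos i)" using p H(1) nd_weaken by blast
      moreover have "Cl \<subseteq> H" using H(1) Imp.prems(2) by simp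
      ultimately show "forces H B" using A B H(2) c(1) by (meson ImpE nd_mp subsetD)
    qed
  qed
next
  case (Conj A B)
  let ?j = "i + 1 + length (enc A)"
  have c: "Imp (vpos i) (vpos (i + 1)) \<in> G" "Imp (vpos i) (vpos ?j) \<in> G"
    "Imp (vpos (i + 1)) (Imp (vpos ?j) (vpos i)) \<in> G"
    using Conj.prems(1,2) by (auto simp add: Let_def)
  have "forces G A \<longleftrightarrow> nd G (vpos (i + 1))" "forces G B \<longleftrightarrow> nd G (vpos ?j)"
    using Conj.IH(1)[of "i + 1" G] Conj.IH(2)[of ?j G] Conj.prems by (simp_all add: Let_def)
  with c show ?case unfolding forces.simps(4) by (meson ImpE nd_mp)
next
  case (Disj A B)
  let ?j = "i + 1 + length (enc A)"
  have c: "Imp (vpos (i + 1)) (vpos i) \<in> Cl" "Imp (vpos ?j) (vpos i) \<in> Cl"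
    "\<And>r. r \<le> n \<Longrightarrow> Imp (vpos i) (Imp (Imp (vpos (i + 1)) (vpos r)) (Imp (Imp (vpos ?j) (vpos r)) (vpos r))) \<in> Cl"
    using Disj.prems(1) by (auto simp: Let_def image_subset_iff simp del: upt_Suc)
  have A: "forces H A \<longleftrightarrow> nd H (vpos (i + 1))" and B: "forces H B \<longleftrightarrow> nd H (vpos ?j)" if "Cl \<subseteq> H" for H
    using Disj.IH(1)[of "i + 1" H] Disj.IH(2)[of ?j H] Disj.prems that by (simp_all add: Let_def)
  show ?case
  proof
    assume f: "forces G (Disj A B)"
    \<comment> \<open>The disjunction is eliminated into its own name, \<open>r = i\<close>; the two
      introduction clauses settle the branches.\<close>
    have i: "i \<le> n" using Disj.prems(3) by simp
    have "\<forall>K. G \<subseteq> K \<longrightarrow> forces K A \<longrightarrow> nd K (vpos i)" "\<forall>K. G \<subseteq> K \<longrightarrow> forces K B \<longrightarrow> nd K (vpos i)"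
      using A B c(1,2) Disj.prems(2) nd_mp by (meson subset_iff)+
    then show "nd G (vpos i)" using f i unfolding forces.simps(5) by blast
  next
    assume p: "nd G (vpos i)"
    show "forces G (Disj A B)" unfolding forces.simps(5)
    proof (intro allI impI)
      fix r H assume r: "r \<le> n" and H: "G \<subseteq> H"
        and a: "\<forall>K. H \<subseteq> K \<longrightarrow> forces K A \<longrightarrow> nd K (vpos r)"
        and b: "\<forall>K. H \<subseteq> K \<longrightarrow> forces K B \<longrightarrow> nd K (vpos r)"
      have C: "Cl \<subseteq> H" using H Disj.prems(2) by simp
      have "nd (insert (vpos (i + 1)) H) (vpos r)" using a A C
        by (meson Assm insertI1 subset_insertI subset_insertI2)
      moreover have "nd (insert (vpos ?j) H) (vpos r)" using b B C
        by (meson Assm insertI1 subset_insertI subset_insertI2)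
      moreover have "nd H (vpos i)" using p H nd_weaken by blast
      ultimately show "nd H (vpos r)" using c(3)[OF r] C by (meson ImpE ImpI nd_mp subsetD)
    qed
  qed
qed

end

lemma transl_complete:
  assumes "provable \<phi>" shows "provable (transl \<phi>)"
proof -
  let ?n = "length (enc \<phi>)"
  let ?Cl = "set (clauses ?n 1 \<phi>)"
  \<comment> \<open>The world chosen is the set of clauses itself, where derivability of the root
    name is exactly what the translation asserts.\<close>
  have "forces ?Cl ?n ?Cl \<phi>" using assms forces_nd[of "{}"] by (simp add: provable_def)
  then have "nd ?Cl (vpos 1)" using forces_iff_nd[of ?n 1 \<phi> ?Cl ?Cl] by simp
  then show ?thesis by (simp add: provable_def transl_def nd_imps)
qed

section \<open>A program printing the clauses\<close>

definition hif :: "(cell \<Rightarrow> bool) \<Rightarrow> com \<Rightarrow> com \<Rightarrow> com" where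
  "hif Q = If (\<lambda>a _ _. Q a)"
definition hwhile :: "(cell \<Rightarrow> bool) \<Rightarrow> com \<Rightarrow> com" where
  "hwhile Q = While (\<lambda>a _ _. Q a)"
text \<open>Testing a counter takes many machine steps and cannot serve as a loop condition; it is
  run before the loop and after each round, leaving the answer in the flag.\<close>

definition cwhile :: "nat \<Rightarrow> com \<Rightarrow> com" where
  "cwhile j c = nonzero j ;; While (\<lambda>_ _ f. f) (c ;; nonzero j)"

fun emits :: "sym list \<Rightarrow> com" where
  "emits [] = head S"
| "emits (a # as) = emit_sym a ;; emits as"

definition copy_cell :: com where
  "copy_cell = Act (\<lambda>a b f. (f, b, S, S, case a of Sy s \<Rightarrow> Some s | _ \<Rightarrow> None))"

definition rewind :: com where
  "rewind = hwhile (\<lambda>a. a \<noteq> LEnd) (head L)"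

text \<open>Turns the position of the input head into a counter value; choosing \<open>as\<close> as
  a single zero prints that position in unary on the way.\<close>

definition rewind_count :: "nat \<Rightarrow> sym list \<Rightarrow> com" where
  "rewind_count j as = hwhile (\<lambda>a. a \<noteq> LEnd) (head L ;; inc j ;; emits as)"

definition forward :: com where
  "forward = cwhile 2 (dec 2 ;; head R)"

text \<open>Counting a counter down destroys it, so its units are collected in the scratch counter
  2, from which \<open>unshift\<close> restores it.\<close>

definition shift :: "nat \<Rightarrow> sym list \<Rightarrow> com" where
  "shift j as = cwhile j (dec j ;; inc 2 ;; emits as)"

definition unshift :: "nat \<Rightarrow> com" where
  "unshift j = cwhile 2 (dec 2 ;; inc j)"

definition print_counter :: "nat \<Rightarrow> com" where
  "print_counter j = shift j [SZero] ;; unshift j"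

definition print_head :: com where
  "print_head = rewind_count 2 [SZero] ;; forward"

text \<open>Counter 0 is drained and then rebuilt one unit per head move, so it ends up intact with
  the head at the position it stores.\<close>

definition return_to_node :: com where
  "return_to_node = rewind ;; shift 0 [] ;; cwhile 2 (dec 2 ;; inc 0 ;; head R)"

lemma concat_replicate_single: "concat (replicate k [a]) = replicate k a"
  by (induction k) auto

text \<open>Counter 0 holds the position of the current node, counter 1 that of its right subformula;
  the left subformula starts right after the node.\<close>

datatype piece = Lit sym | PosNode | PosLeft | PosRight | PosHead

fun print_piece :: "piece \<Rightarrow> com" where
  "print_piece (Lit a) = emit_sym a"
| "print_piece PosNode = emits [SVar, SOne] ;; print_counter 0 ;; emits [SEnd]"
| "print_piece PosLeft = emits [SVar, SOne] ;; print_counter 0 ;; emits [SZero, SEnd]"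
| "print_piece PosRight = emits [SVar, SOne] ;; print_counter 1 ;; emits [SEnd]"
| "print_piece PosHead = emits [SVar, SOne] ;; print_head ;; emits [SEnd]"

fun prints :: "piece list \<Rightarrow> com" where
  "prints [] = head S"
| "prints (p # ps) = print_piece p ;; prints ps"

fun piece_out :: "nat \<Rightarrow> nat \<Rightarrow> nat \<Rightarrow> piece \<Rightarrow> sym list" where
  "piece_out i j r (Lit a) = [a]"
| "piece_out i j r PosNode = enc (vpos i)"
| "piece_out i j r PosLeft = enc (vpos (i + 1))"
| "piece_out i j r PosRight = enc (vpos j)"
| "piece_out i j r PosHead = enc (vpos r)"

definition outs :: "nat \<Rightarrow> nat \<Rightarrow> nat \<Rightarrow> piece list \<Rightarrow> sym list" where
  "outs i j r ps = concat (map (piece_out i j r) ps)"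

text \<open>The input head is the loop variable \<open>r\<close>, which saves a counter: printing
  its position borrows the scratch counter and puts the head back.\<close>

definition for_heads :: "piece list \<Rightarrow> com" where
  "for_heads ps = hwhile (\<lambda>a. a \<noteq> REnd) (prints ps ;; head R)"

text \<open>In Polish notation a subformula ends where the number of operands still expected, kept in
  counter 2, drops to zero.\<close>

definition scan_body :: com where
  "scan_body = hif (\<lambda>a. a \<in> Sy ` {SImp, SConj, SDisj}) (inc 2)
     (hif (\<lambda>a. a \<in> Sy ` {SEnd, SBot}) (dec 2) (head S)) ;; head R"

text \<open>Right after the connective one operand has to be skipped, hence the initial 1 in counter
  2. When it vanishes, the head stands on the first cell of the right operand, and rewinding stores
  that position in counter 1.\<close>

definition find_right :: com where
  "find_right = head R ;; inc 2 ;; cwhile 2 scan_body ;; rewind_count 1 []"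

definition clear_right :: com where
  "clear_right = cwhile 1 (dec 1)"

definition copy_name :: com where
  "copy_name = head R ;; emits [SVar, SOne, SOne] ;;
     hwhile (\<lambda>a. a \<in> Sy ` {SZero, SOne}) (copy_cell ;; head R) ;; emits [SEnd]"

text \<open>Here and in the lists below, the first \<open>SImp\<close> of each clause belongs to the
  outer chain of implications and the second to the clause. Copying a name moves the head away from
  the node, which is why it has to return before the second copy.\<close>

definition var_node :: com where
  "var_node = prints [Lit SImp, Lit SImp, PosNode] ;; copy_name ;; return_to_node ;;
     prints [Lit SImp, Lit SImp] ;; copy_name ;; prints [PosNode] ;; return_to_node"

definition bot_node :: com where
  "bot_node = rewind ;; for_heads [Lit SImp, Lit SImp, PosNode, PosHead] ;; return_to_node"

definition imp_pieces :: "piece list" where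
  "imp_pieces = [Lit SImp, Lit SImp, PosNode, Lit SImp, PosLeft, PosRight,
     Lit SImp, Lit SImp, Lit SImp, PosLeft, PosRight, PosNode]"

definition conj_pieces :: "piece list" where
  "conj_pieces = [Lit SImp, Lit SImp, PosNode, PosLeft, Lit SImp, Lit SImp, PosNode, PosRight,
     Lit SImp, Lit SImp, PosLeft, Lit SImp, PosRight, PosNode]"

definition disj_pieces :: "piece list" where
  "disj_pieces = [Lit SImp, Lit SImp, PosLeft, PosNode, Lit SImp, Lit SImp, PosRight, PosNode]"

definition cases_pieces :: "piece list" where
  "cases_pieces = [Lit SImp, Lit SImp, PosNode, Lit SImp, Lit SImp, PosLeft, PosHead,
     Lit SImp, Lit SImp, PosRight, PosHead, PosHead]"

definition binary_node :: "com \<Rightarrow> com" where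
  "binary_node c = find_right ;; c ;; clear_right ;; return_to_node"

definition node :: com where
  "node = hif (\<lambda>a. a = Sy SVar) var_node
    (hif (\<lambda>a. a = Sy SBot) bot_node
    (hif (\<lambda>a. a = Sy SImp) (binary_node (prints imp_pieces))
    (hif (\<lambda>a. a = Sy SConj) (binary_node (prints conj_pieces))
    (hif (\<lambda>a. a = Sy SDisj) (binary_node (prints disj_pieces ;; for_heads cases_pieces))
    (head S)))))"

definition node_loop :: com where
  "node_loop = hwhile (\<lambda>a. a \<noteq> REnd) (node ;; head R ;; inc 0)"

definition transl_com :: com where
  "transl_com = put_bit True ;; head R ;; inc 0 ;; node_loop ;; emits (enc (vpos 1))"

lemma enc_vpos: "enc (vpos i) = SVar # SOne # replicate i SZero @ [SEnd]"
  by (simp add: bin_pow2)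

lemma enc_vext: "enc (vext k) = SVar # SOne # SOne # bin k @ [SEnd]"
  by (simp add: bin_xcode)

lemma set_bin: "set (bin n) \<subseteq> {SZero, SOne}"
proof (induction n rule: less_induct)
  case (less n)
  show ?case
  proof (cases "n < 2")
    case True
    then show ?thesis by (subst bin.simps) simp
  next
    case False
    then show ?thesis using less[of "n div 2"] by (subst bin.simps) simp
  qed
qed

definition prefixes :: "form list \<Rightarrow> sym list" where
  "prefixes Cs = concat (map (\<lambda>C. SImp # enc C) Cs)"

lemma prefixes_simps [simp]:
  "prefixes [] = []" "prefixes (C # Cs) = SImp # enc C @ prefixes Cs"
  "prefixes (Cs @ Ds) = prefixes Cs @ prefixes Ds"
  by (simp_all add: prefixes_def)

lemma enc_foldr_Imp: "enc (foldr Imp Cs A) = prefixes Cs @ enc A"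
  by (induction Cs) simp_all

section \<open>A total-correctness calculus for counter programs\<close>

type_synonym ast = "nat \<times> (nat \<Rightarrow> nat) \<times> sym list"

text \<open>\<open>M\<close> bounds all counter values and matches the argument of the logarithm in
  the space bound; the first assumption says that \<open>W\<close> leaves room for every number of
  blocks that such counters can cause.\<close>

locale transducer =
  fixes x :: "sym list" and M W :: nat
  assumes W: "\<And>u. 2 ^ u \<le> 2 * M \<Longrightarrow> 5 * u + 10 \<le> W"
    and M: "M = length x + 2"
begin

text \<open>The flag is left free and the number of blocks is hidden, so programs are specified by
  head, counters and output alone; the inequality on \<open>u\<close> is the space
  invariant.\<close>

fun models :: "mem \<Rightarrow> ast \<Rightarrow> bool" where
  "models (f, h', tp, w, ou') (h, v, ou) \<longleftrightarrow>
     h' = h \<and> ou' = ou \<and> w = 0 \<and> (\<exists>u. rep u v tp \<and> 2 ^ u \<le> 2 * M)"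

definition does :: "com \<Rightarrow> ast \<Rightarrow> ast \<Rightarrow> bool" where
  "does c s s' \<longleftrightarrow> (\<forall>m. models m s \<longrightarrow> (\<exists>m'. exec W x c m m' \<and> models m' s'))"

lemma doesI:
  assumes "\<And>f tp u. rep u v tp \<Longrightarrow> 2 ^ u \<le> 2 * M \<Longrightarrow> 5 * u + 10 \<le> W \<Longrightarrow>
    \<exists>f' tp' u'. exec W x c (f, h, tp, 0, ou) (f', h', tp', 0, ou') \<and> rep u' v' tp' \<and> 2 ^ u' \<le> 2 * M"
  shows "does c (h, v, ou) (h', v', ou')"
  unfolding does_def
proof (intro allI impI)
  fix m assume "models m (h, v, ou)"
  then obtain f tp u where m: "m = (f, h, tp, 0, ou)" "rep u v tp" "2 ^ u \<le> 2 * M"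
    by (cases m) auto
  from assms[OF m(2,3) W[OF m(3)]] show "\<exists>m'. exec W x c m m' \<and> models m' (h', v', ou')"
    unfolding m(1) by fastforce
qed

lemma does_Seq: "does c1 s s1 \<Longrightarrow> does c2 s1 s2 \<Longrightarrow> does (c1 ;; c2) s s2"
  unfolding does_def by (meson exec_Seq)

lemma does_eq: "does c s s1 \<Longrightarrow> s1 = s2 \<Longrightarrow> does c s s2"
  by simp

lemma does_head: "does (head d) (h, v, ou) (move_in (length x) h d, v, ou)"
proof (rule doesI)
  fix f tp u assume "rep u v tp" "2 ^ u \<le> 2 * M"
  moreover have "exec W x (head d) (f, h, tp, 0, ou) (f, move_in (length x) h d, tp, 0, ou)"
    unfolding head_def by (rule Act_eq, rule refl) simp_all
  ultimately show "\<exists>f' tp' u'. exec W x (head d) (f, h, tp, 0, ou) (f', move_in (length x) h d, tp', 0, ou) \<and>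
    rep u' v tp' \<and> 2 ^ u' \<le> 2 * M" by blast
qed

lemma does_left: "does (head L) (Suc h, v, ou) (h, v, ou)"
  using does_head[of L "Suc h"] by simp

lemma does_right: "h \<le> length x \<Longrightarrow> does (head R) (h, v, ou) (Suc h, v, ou)"
  using does_head[of R h] by simp

lemma does_skip: "does (head S) (h, v, ou) (h, v, ou)"
  using does_head[of S h] by simp

lemma does_emit: "does (emit_sym a) (h, v, ou) (h, v, ou @ [a])"
proof (rule doesI)
  fix f tp u assume "rep u v tp" "2 ^ u \<le> 2 * M"
  moreover have "exec W x (emit_sym a) (f, h, tp, 0, ou) (f, h, tp, 0, ou @ [a])"
    unfolding emit_sym_def by (rule Act_eq, rule refl) simp_all
  ultimately show "\<exists>f' tp' u'. exec W x (emit_sym a) (f, h, tp, 0, ou) (f', h, tp', 0, ou @ [a]) \<and>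
    rep u' v tp' \<and> 2 ^ u' \<le> 2 * M" by blast
qed

lemma does_copy_cell:
  assumes "read_in x h = Sy a" shows "does copy_cell (h, v, ou) (h, v, ou @ [a])"
proof (rule doesI)
  fix f tp u assume "rep u v tp" "2 ^ u \<le> 2 * M"
  moreover have "exec W x copy_cell (f, h, tp, 0, ou) (f, h, tp, 0, ou @ [a])"
    unfolding copy_cell_def by (rule Act_eq, rule refl) (simp_all add: assms)
  ultimately show "\<exists>f' tp' u'. exec W x copy_cell (f, h, tp, 0, ou) (f', h, tp', 0, ou @ [a]) \<and>
    rep u' v tp' \<and> 2 ^ u' \<le> 2 * M" by blast
qed

text \<open>The one operation that can open a block. If it does, \<open>2 ^ u'\<close> equals
  \<open>2 * (v j + 1)\<close>, which \<open>v j < M\<close> keeps within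
  \<open>2 * M\<close>.\<close>

lemma does_inc:
  assumes "j < 3" "v j < M" shows "does (inc j) (h, v, ou) (h, v(j := v j + 1), ou)"
proof (rule doesI)
  fix f tp u assume u: "rep u v tp" "2 ^ u \<le> 2 * M" "5 * u + 10 \<le> W"
  from exec_inc[OF u(1) assms(1) u(3), of x f h ou] obtain u' tp' where
    "exec W x (inc j) (f, h, tp, 0, ou) (f, h, tp', 0, ou)" "rep u' (v(j := v j + 1)) tp'"
    "u' = u \<or> u' = Suc u \<and> v j + 1 = 2 ^ u" by blast
  moreover from this(3) u(2) assms(2) have "2 ^ u' \<le> 2 * M" by auto
  ultimately show "\<exists>f' tp' u'. exec W x (inc j) (f, h, tp, 0, ou) (f', h, tp', 0, ou) \<and>
    rep u' (v(j := v j + 1)) tp' \<and> 2 ^ u' \<le> 2 * M" by blast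
qed

lemma does_dec:
  assumes "j < 3" "0 < v j" shows "does (dec j) (h, v, ou) (h, v(j := v j - 1), ou)"
proof (rule doesI)
  fix f tp u assume u: "rep u v tp" "2 ^ u \<le> 2 * M" "5 * u + 10 \<le> W"
  from exec_dec[OF u(1) assms(1) u(3) assms(2), of x f h ou] u(2)
  show "\<exists>f' tp' u'. exec W x (dec j) (f, h, tp, 0, ou) (f', h, tp', 0, ou) \<and>
    rep u' (v(j := v j - 1)) tp' \<and> 2 ^ u' \<le> 2 * M" by blast
qed

lemma exec_nonzero_models:
  assumes "models m (h, v, ou)" "j < 3"
  shows "\<exists>tp. exec W x (nonzero j) m (v j \<noteq> 0, h, tp, 0, ou) \<and> models (v j \<noteq> 0, h, tp, 0, ou) (h, v, ou)"
proof -
  from assms(1) obtain f tp u where m: "m = (f, h, tp, 0, ou)" "rep u v tp" "2 ^ u \<le> 2 * M"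
    by (cases m) auto
  with exec_nonzero[OF m(2) assms(2) W[OF m(3)], of x f h ou] show ?thesis by auto
qed

lemma does_cwhile_exit:
  assumes "j < 3" "v j = 0" shows "does (cwhile j c) (h, v, ou) (h, v, ou)"
  unfolding does_def
proof (intro allI impI)
  fix m assume "models m (h, v, ou)"
  from exec_nonzero_models[OF this assms(1)] assms(2) obtain tp where
    "exec W x (nonzero j) m (False, h, tp, 0, ou)" "models (False, h, tp, 0, ou) (h, v, ou)" by auto
  moreover have "exec W x (While (\<lambda>_ _ f. f) (c ;; nonzero j)) (False, h, tp, 0, ou) (False, h, tp, 0, ou)"
    by (rule exec_WhileF) simp
  ultimately show "\<exists>m'. exec W x (cwhile j c) m m' \<and> models m' (h, v, ou)"
    unfolding cwhile_def by (meson exec_Seq)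
qed

text \<open>The opening test of the remaining \<open>cwhile\<close> run is split off and becomes the
  closing test of the first round.\<close>

lemma does_cwhile_step:
  assumes "j < 3" "0 < v j" and c: "does c (h, v, ou) s1" and rest: "does (cwhile j c) s1 s2"
  shows "does (cwhile j c) (h, v, ou) s2"
  unfolding does_def
proof (intro allI impI)
  let ?L = "While (\<lambda>_ _ f. f) (c ;; nonzero j)"
  fix m assume "models m (h, v, ou)"
  from exec_nonzero_models[OF this assms(1)] assms(2) obtain tp where
    1: "exec W x (nonzero j) m (True, h, tp, 0, ou)" "models (True, h, tp, 0, ou) (h, v, ou)" by auto
  from c 1(2) obtain m1 where m1: "exec W x c (True, h, tp, 0, ou) m1" "models m1 s1"
    unfolding does_def by blast
  from rest m1(2) obtain m2 where m2: "exec W x (cwhile j c) m1 m2" "models m2 s2"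
    unfolding does_def by blast
  from m2(1) obtain m3 where m3: "exec W x (nonzero j) m1 m3" "exec W x ?L m3 m2"
    unfolding cwhile_def by (auto elim: exec.cases)
  have "exec W x ?L (True, h, tp, 0, ou) m2"
    by (rule exec_WhileT[OF _ exec_Seq[OF m1(1) m3(1)] m3(2)]) simp
  with 1(1) m2(2) show "\<exists>m'. exec W x (cwhile j c) m m' \<and> models m' s2"
    unfolding cwhile_def by (meson exec_Seq)
qed

lemma does_hif:
  "Q (read_in x h) \<Longrightarrow> does c1 (h, v, ou) s \<Longrightarrow> does (hif Q c1 c2) (h, v, ou) s"
  "\<not> Q (read_in x h) \<Longrightarrow> does c2 (h, v, ou) s \<Longrightarrow> does (hif Q c1 c2) (h, v, ou) s"
  unfolding does_def hif_def by (fastforce intro: exec_IfT exec_IfF)+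

lemma does_hwhile_exit:
  "\<not> Q (read_in x h) \<Longrightarrow> does (hwhile Q c) (h, v, ou) (h, v, ou)"
  unfolding does_def hwhile_def by (fastforce intro: exec_WhileF)

lemma does_hwhile_step:
  assumes "Q (read_in x h)" "does c (h, v, ou) s1" "does (hwhile Q c) s1 s2"
  shows "does (hwhile Q c) (h, v, ou) s2"
  unfolding does_def
proof (intro allI impI)
  fix m assume m: "models m (h, v, ou)"
  from assms(2) m obtain m1 where m1: "exec W x c m m1" "models m1 s1" unfolding does_def by blast
  from assms(3) m1(2) obtain m2 where m2: "exec W x (hwhile Q c) m1 m2" "models m2 s2"
    unfolding does_def by blast
  from m obtain f tp where "m = (f, h, tp, 0, ou)" by (cases m) auto
  with m1(1) m2(1) assms(1) have "exec W x (hwhile Q c) m m2"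
    unfolding hwhile_def by (auto intro: exec_WhileT)
  with m2(2) show "\<exists>m'. exec W x (hwhile Q c) m m' \<and> models m' s2" by blast
qed

lemma does_emits: "does (emits as) (h, v, ou) (h, v, ou @ as)"
proof (induction as arbitrary: ou)
  case Nil
  then show ?case using does_skip by simp
next
  case (Cons a as)
  show ?case using does_Seq[OF does_emit Cons[of "ou @ [a]"]] by simp
qed

lemma read_LEnd: "read_in x h = LEnd \<longleftrightarrow> h = 0"
  by (simp add: read_in_def)

lemma read_REnd: "read_in x h = REnd \<longleftrightarrow> length x < h"
  by (auto simp: read_in_def)

lemma does_rewind: "does rewind (h, v, ou) (0, v, ou)"
  unfolding rewind_def
proof (induction h)
  case (Suc h)
  show ?case by (rule does_hwhile_step[OF _ does_left Suc]) (simp add: read_LEnd)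
qed (simp add: does_hwhile_exit read_LEnd)

lemma does_rewind_count:
  assumes "j < 3" "v j + h \<le> M"
  shows "does (rewind_count j as) (h, v, ou) (0, v(j := v j + h), ou @ concat (replicate h as))"
  using assms(2)
proof (induction h arbitrary: v ou)
  case 0
  then show ?case unfolding rewind_count_def using does_hwhile_exit[of _ 0] by (simp add: read_LEnd)
next
  case (Suc h)
  let ?v = "v(j := v j + 1)"
  have 1: "does (head L ;; inc j ;; emits as) (Suc h, v, ou) (h, ?v, ou @ as)"
    by (intro does_Seq[OF does_left] does_Seq[OF does_inc does_emits]) (use assms(1) Suc.prems in auto)
  have "does (rewind_count j as) (h, ?v, ou @ as)
      (0, ?v(j := ?v j + h), (ou @ as) @ concat (replicate h as))"
    by (rule Suc.IH) (use Suc.prems in simp)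
  moreover have "?v(j := ?v j + h) = v(j := v j + Suc h)" by auto
  ultimately have "does (rewind_count j as) (h, ?v, ou @ as)
      (0, v(j := v j + Suc h), ou @ concat (replicate (Suc h) as))"
    by (simp only: append_assoc replicate_Suc concat.simps)
  from does_hwhile_step[OF _ 1 this[unfolded rewind_count_def]] show ?case
    unfolding rewind_count_def by (simp only: read_LEnd)
qed

lemma does_forward: "v 2 = k \<Longrightarrow> h + k \<le> length x + 1 \<Longrightarrow> does forward (h, v, ou) (h + k, v(2 := 0), ou)"
proof (induction k arbitrary: h v)
  case 0
  then show ?case unfolding forward_def using does_cwhile_exit[of 2 v] by (simp add: fun_upd_idem)
next
  case (Suc k)
  let ?v = "v(2 := v 2 - 1)"
  have 1: "does (dec 2 ;; head R) (h, v, ou) (Suc h, ?v, ou)"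
    by (intro does_Seq[OF does_dec does_right]) (use Suc.prems in auto)
  have "does forward (Suc h, ?v, ou) (Suc h + k, ?v(2 := 0), ou)"
    by (rule Suc.IH) (use Suc.prems in auto)
  then have 2: "does forward (Suc h, ?v, ou) (h + Suc k, v(2 := 0), ou)"
    by (simp only: add_Suc add_Suc_right fun_upd_upd)
  show ?case unfolding forward_def
    by (rule does_cwhile_step[OF _ _ 1 2[unfolded forward_def]]) (use Suc.prems in simp_all)
qed

lemma does_shift:
  assumes "j < 2"
  shows "v j = k \<Longrightarrow> v 2 + k \<le> M \<Longrightarrow> does (shift j as) (h, v, ou)
    (h, v(j := 0, 2 := v 2 + k), ou @ concat (replicate k as))"
proof (induction k arbitrary: v ou)
  case 0
  then show ?case unfolding shift_def using does_cwhile_exit[of j v] assms by (simp add: fun_upd_idem)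
next
  case (Suc k)
  let ?v = "v(j := v j - 1)"
  let ?v' = "?v(2 := ?v 2 + 1)"
  have 1: "does (dec j ;; inc 2 ;; emits as) (h, v, ou) (h, ?v', ou @ as)"
    by (intro does_Seq[OF does_dec] does_Seq[OF does_inc does_emits]) (use assms Suc.prems in auto)
  have "does (shift j as) (h, ?v', ou @ as) (h, ?v'(j := 0, 2 := ?v' 2 + k), (ou @ as) @ concat (replicate k as))"
    by (rule Suc.IH) (use Suc.prems assms in auto)
  moreover have "?v'(j := 0, 2 := ?v' 2 + k) = v(j := 0, 2 := v 2 + Suc k)" using assms by auto
  ultimately have 2: "does (shift j as) (h, ?v', ou @ as)
      (h, v(j := 0, 2 := v 2 + Suc k), ou @ concat (replicate (Suc k) as))"
    by (simp only: append_assoc replicate_Suc concat.simps)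
  show ?case unfolding shift_def
    by (rule does_cwhile_step[OF _ _ 1 2[unfolded shift_def]]) (use assms Suc.prems in simp_all)
qed

lemma does_unshift:
  assumes "j < 2"
  shows "v 2 = k \<Longrightarrow> v j + k \<le> M \<Longrightarrow> does (unshift j) (h, v, ou) (h, v(2 := 0, j := v j + k), ou)"
proof (induction k arbitrary: v)
  case 0
  then show ?case unfolding unshift_def using does_cwhile_exit[of 2 v] assms by (simp add: fun_upd_idem)
next
  case (Suc k)
  let ?v = "v(2 := v 2 - 1)"
  let ?v' = "?v(j := ?v j + 1)"
  have 1: "does (dec 2 ;; inc j) (h, v, ou) (h, ?v', ou)"
    by (intro does_Seq[OF does_dec does_inc]) (use assms Suc.prems in auto)
  have "does (unshift j) (h, ?v', ou) (h, ?v'(2 := 0, j := ?v' j + k), ou)"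
    by (rule Suc.IH) (use Suc.prems assms in auto)
  moreover have "?v'(2 := 0, j := ?v' j + k) = v(2 := 0, j := v j + Suc k)" using assms by auto
  ultimately have 2: "does (unshift j) (h, ?v', ou) (h, v(2 := 0, j := v j + Suc k), ou)"
    by (simp only:)
  show ?case unfolding unshift_def
    by (rule does_cwhile_step[OF _ _ 1 2[unfolded unshift_def]]) (use assms Suc.prems in simp_all)
qed

lemma does_print_counter:
  assumes "j < 2" "v 2 = 0" "v j \<le> M"
  shows "does (print_counter j) (h, v, ou) (h, v, ou @ replicate (v j) SZero)"
proof -
  let ?v = "v(j := 0, 2 := v 2 + v j)"
  have "does (shift j [SZero]) (h, v, ou) (h, ?v, ou @ replicate (v j) SZero)"
    using does_shift[of j v "v j" "[SZero]" h ou] assms by (simp add: concat_replicate_single)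
  moreover have "does (unshift j) (h, ?v, ou @ replicate (v j) SZero)
      (h, ?v(2 := 0, j := ?v j + v j), ou @ replicate (v j) SZero)"
    by (rule does_unshift) (use assms in auto)
  moreover have "?v(2 := 0, j := ?v j + v j) = v" using assms by auto
  ultimately show ?thesis unfolding print_counter_def by (auto intro: does_Seq)
qed

lemma does_print_head:
  assumes "v 2 = 0" "h \<le> length x + 1"
  shows "does print_head (h, v, ou) (h, v, ou @ replicate h SZero)"
proof -
  let ?v = "v(2 := h)"
  have "does (rewind_count 2 [SZero]) (h, v, ou) (0, ?v, ou @ replicate h SZero)"
    using does_rewind_count[of 2 v h "[SZero]" ou] assms M by (simp add: concat_replicate_single)
  moreover have "does forward (0, ?v, ou @ replicate h SZero) (0 + h, ?v(2 := 0), ou @ replicate h SZero)"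
    by (rule does_forward) (use assms in auto)
  moreover have "?v(2 := 0) = v" using assms by auto
  ultimately show ?thesis unfolding print_head_def by (auto intro: does_Seq)
qed

lemma does_return_loop:
  "v 2 = k \<Longrightarrow> v 0 + k \<le> M \<Longrightarrow> h + k \<le> length x + 1 \<Longrightarrow>
    does (cwhile 2 (dec 2 ;; inc 0 ;; head R)) (h, v, ou) (h + k, v(2 := 0, 0 := v 0 + k), ou)"
proof (induction k arbitrary: h v)
  case 0
  then show ?case using does_cwhile_exit[of 2 v] by (simp add: fun_upd_idem)
next
  case (Suc k)
  let ?v = "v(2 := v 2 - 1)"
  let ?v' = "?v(0 := ?v 0 + 1)"
  have 1: "does (dec 2 ;; inc 0 ;; head R) (h, v, ou) (Suc h, ?v', ou)"
    by (intro does_Seq[OF does_dec] does_Seq[OF does_inc does_right]) (use Suc.prems in auto)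
  have "does (cwhile 2 (dec 2 ;; inc 0 ;; head R)) (Suc h, ?v', ou)
      (Suc h + k, ?v'(2 := 0, 0 := ?v' 0 + k), ou)"
    by (rule Suc.IH) (use Suc.prems in auto)
  moreover have "?v'(2 := 0, 0 := ?v' 0 + k) = v(2 := 0, 0 := v 0 + Suc k)" by auto
  ultimately have 2: "does (cwhile 2 (dec 2 ;; inc 0 ;; head R)) (Suc h, ?v', ou)
      (h + Suc k, v(2 := 0, 0 := v 0 + Suc k), ou)"
    by (simp only: add_Suc add_Suc_right)
  show ?case by (rule does_cwhile_step[OF _ _ 1 2]) (use Suc.prems in simp_all)
qed

lemma does_return:
  assumes "v 2 = 0" "v 0 \<le> length x + 1"
  shows "does return_to_node (h, v, ou) (v 0, v, ou)"
proof -
  let ?v = "v(0 := 0, 2 := v 2 + v 0)"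
  have "does (shift 0 []) (0, v, ou) (0, ?v, ou)"
    using does_shift[of 0 v "v 0" "[]" 0 ou] assms M by simp
  moreover have "does (cwhile 2 (dec 2 ;; inc 0 ;; head R)) (0, ?v, ou)
      (0 + v 0, ?v(2 := 0, 0 := ?v 0 + v 0), ou)"
    by (rule does_return_loop) (use assms M in auto)
  moreover have "?v(2 := 0, 0 := ?v 0 + v 0) = v" using assms by auto
  ultimately show ?thesis unfolding return_to_node_def by (auto intro!: does_Seq[OF does_rewind] intro: does_Seq)
qed

section \<open>Words on the input tape and the search for the right operand\<close>

definition seg :: "nat \<Rightarrow> sym list \<Rightarrow> bool" where
  "seg h w \<longleftrightarrow> (\<exists>pre post. x = pre @ w @ post \<and> h = Suc (length pre))"

lemma seg_append: "seg h (w1 @ w2) \<Longrightarrow> seg h w1 \<and> seg (h + length w1) w2"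
  unfolding seg_def
proof (elim exE conjE, intro conjI)
  fix pre post assume *: "x = pre @ (w1 @ w2) @ post" "h = Suc (length pre)"
  show "\<exists>pre post. x = pre @ w1 @ post \<and> h = Suc (length pre)"
    using * by (intro exI[of _ pre] exI[of _ "w2 @ post"]) simp
  show "\<exists>pre post. x = pre @ w2 @ post \<and> h + length w1 = Suc (length pre)"
    using * by (intro exI[of _ "pre @ w1"] exI[of _ post]) simp
qed

lemma seg_Cons: "seg h (a # w) \<Longrightarrow> read_in x h = Sy a \<and> seg (Suc h) w"
  using seg_append[of h "[a]" w] by (auto simp: seg_def[of h "[a]"] read_in_def)

lemma seg_length: "seg h w \<Longrightarrow> h + length w \<le> Suc (length x)"
  by (auto simp: seg_def)

lemma read_Sy: "read_in x h = Sy a \<Longrightarrow> h \<le> length x"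
  by (auto simp: read_in_def split: if_splits)

lemma does_print_piece:
  assumes "v 2 = 0" "v 0 \<le> M" "v 1 \<le> M" "h \<le> length x + 1"
  shows "does (print_piece p) (h, v, ou) (h, v, ou @ piece_out (v 0) (v 1) h p)"
proof -
  have ctr: "does (emits [SVar, SOne] ;; print_counter j ;; emits as) (h, v, ou)
      (h, v, ou @ SVar # SOne # replicate (v j) SZero @ as)" if "j < 2" "v j \<le> M" for j as
    by (rule does_eq, rule does_Seq[OF does_emits does_Seq[OF does_print_counter[OF that(1) assms(1) that(2)] does_emits]]) simp
  have ph: "does print_head (h, v, ou) (h, v, ou @ replicate h SZero)" for ou
    using does_print_head assms by blast
  have hd: "does (emits [SVar, SOne] ;; print_head ;; emits [SEnd]) (h, v, ou)
      (h, v, ou @ SVar # SOne # replicate h SZero @ [SEnd])"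
    by (rule does_eq, rule does_Seq[OF does_emits does_Seq[OF ph does_emits]]) simp
  show ?thesis
  proof (cases p)
    case PosLeft
    have "enc (vpos (v 0 + 1)) = SVar # SOne # replicate (v 0) SZero @ [SZero, SEnd]"
      by (simp only: enc_vpos) (simp add: replicate_append_same[symmetric] del: replicate_append_same)
    with PosLeft ctr[of 0 "[SZero, SEnd]"] assms show ?thesis by (simp del: emits.simps enc.simps)
  qed (use does_emit ctr[of 0 "[SEnd]"] ctr[of 1 "[SEnd]"] hd assms in
      \<open>simp_all del: enc.simps emits.simps add: enc_vpos\<close>)
qed

lemma does_prints:
  assumes "v 2 = 0" "v 0 \<le> M" "v 1 \<le> M" "h \<le> length x + 1"
  shows "does (prints ps) (h, v, ou) (h, v, ou @ outs (v 0) (v 1) h ps)"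
proof (induction ps arbitrary: ou)
  case Nil
  then show ?case using does_skip by (simp add: outs_def)
next
  case (Cons p ps)
  show ?case using does_Seq[OF does_print_piece[OF assms] Cons] by (simp add: outs_def)
qed

lemma does_for_heads:
  assumes "v 2 = 0" "v 0 \<le> M" "v 1 \<le> M" "h \<le> length x + 1"
  shows "does (for_heads ps) (h, v, ou) (length x + 1, v,
    ou @ concat (map (\<lambda>r. outs (v 0) (v 1) r ps) [h..<length x + 1]))"
  using assms(4)
proof (induction "length x + 1 - h" arbitrary: h ou)
  case 0
  then have "h = length x + 1" by simp
  then show ?case unfolding for_heads_def using does_hwhile_exit[of _ h] by (simp add: read_REnd)
next
  case (Suc d)
  then have h: "h \<le> length x" by simp
  have 1: "does (prints ps ;; head R) (h, v, ou) (Suc h, v, ou @ outs (v 0) (v 1) h ps)"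
    using does_Seq[OF does_prints[OF assms(1-3)] does_right] h by simp
  have 2: "does (for_heads ps) (Suc h, v, ou @ outs (v 0) (v 1) h ps) (length x + 1, v,
    (ou @ outs (v 0) (v 1) h ps) @ concat (map (\<lambda>r. outs (v 0) (v 1) r ps) [Suc h..<length x + 1]))"
    by (rule Suc.hyps) (use Suc.hyps(2) h in simp_all)
  have "[h..<length x + 1] = h # [Suc h..<length x + 1]" using h by (simp add: upt_conv_Cons del: upt_Suc)
  with does_hwhile_step[OF _ 1 2[unfolded for_heads_def]] h show ?case
    unfolding for_heads_def by (simp add: read_REnd del: upt_Suc)
qed

lemma scan_neutral:
  assumes "read_in x h = Sy a" "a \<in> {SVar, SZero, SOne}"
  shows "does scan_body (h, v, ou) (Suc h, v, ou)"
  unfolding scan_body_def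
  by (rule does_Seq[OF does_hif(2)[OF _ does_hif(2)[OF _ does_skip]] does_right])
    (use assms read_Sy in auto)

lemma scan_open:
  assumes "read_in x h = Sy a" "a \<in> {SImp, SConj, SDisj}" "v 2 < M"
  shows "does scan_body (h, v, ou) (Suc h, v(2 := v 2 + 1), ou)"
  unfolding scan_body_def
  by (rule does_Seq[OF does_hif(1)[OF _ does_inc] does_right]) (use assms read_Sy in auto)

lemma scan_close:
  assumes "read_in x h = Sy a" "a \<in> {SEnd, SBot}" "0 < v 2"
  shows "does scan_body (h, v, ou) (Suc h, v(2 := v 2 - 1), ou)"
  unfolding scan_body_def
  by (rule does_Seq[OF does_hif(2)[OF _ does_hif(1)[OF _ does_dec]] does_right])
    (use assms read_Sy in auto)

lemma scan_bits:
  assumes "seg h w" "set w \<subseteq> {SZero, SOne}" "0 < v 2"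
    "does (cwhile 2 scan_body) (h + length w, v, ou) s"
  shows "does (cwhile 2 scan_body) (h, v, ou) s"
  using assms
proof (induction w arbitrary: h)
  case (Cons a w)
  then have "read_in x h = Sy a" "seg (Suc h) w" using seg_Cons by blast+
  with Cons have "does scan_body (h, v, ou) (Suc h, v, ou)" "does (cwhile 2 scan_body) (Suc h, v, ou) s"
    by (auto intro: scan_neutral)
  with Cons.prems(3) does_cwhile_step[of 2 v] show ?case by simp
qed simp

text \<open>The connective replaces one expected operand by two, and \<open>w1\<close> and
  \<open>w2\<close> settle one each.\<close>

lemma scan_binary:
  assumes "seg h (a # w1 @ w2)" "a \<in> {SImp, SConj, SDisj}"
    and w1: "\<And>h d. seg h w1 \<Longrightarrow> d + length w1 < M \<Longrightarrow>
      does (cwhile 2 scan_body) (h + length w1, v(2 := d), ou) s \<Longrightarrow>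
      does (cwhile 2 scan_body) (h, v(2 := Suc d), ou) s"
    and w2: "\<And>h d. seg h w2 \<Longrightarrow> d + length w2 < M \<Longrightarrow>
      does (cwhile 2 scan_body) (h + length w2, v(2 := d), ou) s \<Longrightarrow>
      does (cwhile 2 scan_body) (h, v(2 := Suc d), ou) s"
    and d: "d + Suc (length w1 + length w2) < M"
    and s: "does (cwhile 2 scan_body) (h + Suc (length w1 + length w2), v(2 := d), ou) s"
  shows "does (cwhile 2 scan_body) (h, v(2 := Suc d), ou) s"
proof -
  from seg_Cons[OF assms(1)] have r: "read_in x h = Sy a" and "seg (Suc h) (w1 @ w2)" by blast+
  then have g: "seg (Suc h) w1" "seg (Suc h + length w1) w2" using seg_append by blast+
  have "does scan_body (h, v(2 := Suc d), ou) (Suc h, (v(2 := Suc d))(2 := (v(2 := Suc d)) 2 + 1), ou)"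
    by (rule scan_open[OF r assms(2)]) (use d in simp)
  then have 1: "does scan_body (h, v(2 := Suc d), ou) (Suc h, v(2 := Suc (Suc d)), ou)" by simp
  have "does (cwhile 2 scan_body) (Suc h + length w1, v(2 := Suc d), ou) s"
    by (rule w2[OF g(2)]) (use d s in \<open>simp_all add: add_ac\<close>)
  then have 2: "does (cwhile 2 scan_body) (Suc h, v(2 := Suc (Suc d)), ou) s"
    by (rule w1[OF g(1), rotated]) (use d in simp)
  show ?thesis by (rule does_cwhile_step[OF _ _ 1 2]) simp_all
qed

text \<open>Stated backwards, from the run after the subformula to the run before it, with an
  arbitrary outcome \<open>s\<close>; nested operands then chain directly. Each symbol raises the
  count by at most one, which explains the bound by the length.\<close>

lemma scan_enc:
  assumes "seg h (enc A)" "d + length (enc A) < M"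
    "does (cwhile 2 scan_body) (h + length (enc A), v(2 := d), ou) s"
  shows "does (cwhile 2 scan_body) (h, v(2 := Suc d), ou) s"
  using assms
proof (induction A arbitrary: h d)
  case (Var k)
  from Var.prems(1) have r: "read_in x h = Sy SVar" and "seg (Suc h) (bin k @ [SEnd])"
    using seg_Cons by fastforce+
  then have b: "seg (Suc h) (bin k)" "seg (Suc h + length (bin k)) [SEnd]"
    using seg_append by blast+
  have "does scan_body (Suc h + length (bin k), v(2 := Suc d), ou)
      (Suc (Suc h + length (bin k)), (v(2 := Suc d))(2 := (v(2 := Suc d)) 2 - 1), ou)"
    by (rule scan_close) (use seg_Cons[OF b(2)] in auto)
  then have e: "does scan_body (Suc h + length (bin k), v(2 := Suc d), ou)
      (h + length (enc (Var k)), v(2 := d), ou)" by simp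
  have "does (cwhile 2 scan_body) (Suc h + length (bin k), v(2 := Suc d), ou) s"
    by (rule does_cwhile_step[OF _ _ e Var.prems(3)]) simp_all
  then have 2: "does (cwhile 2 scan_body) (Suc h, v(2 := Suc d), ou) s"
    using scan_bits[OF b(1) set_bin, of "v(2 := Suc d)"] by simp
  have 1: "does scan_body (h, v(2 := Suc d), ou) (Suc h, v(2 := Suc d), ou)"
    by (rule scan_neutral[OF r]) simp
  show ?case by (rule does_cwhile_step[OF _ _ 1 2]) simp_all
next
  case Bot
  have "does scan_body (h, v(2 := Suc d), ou) (Suc h, (v(2 := Suc d))(2 := (v(2 := Suc d)) 2 - 1), ou)"
    by (rule scan_close[of _ SBot]) (use Bot seg_Cons in auto)
  then have 1: "does scan_body (h, v(2 := Suc d), ou) (h + length (enc Bot), v(2 := d), ou)" by simp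
  show ?case by (rule does_cwhile_step[OF _ _ 1 Bot.prems(3)]) simp_all
next
  case (Imp A B)
  have h: "seg h (SImp # enc A @ enc B)" using Imp.prems(1) by simp
  show ?case
  proof (rule scan_binary[OF h])
    show "does (cwhile 2 scan_body) (h + Suc (length (enc A) + length (enc B)), v(2 := d), ou) s"
      using Imp.prems(3) by (simp only: enc.simps list.size length_append add_Suc_right add_0_right)
  qed (use Imp.prems(2) in \<open>auto intro: Imp.IH\<close>)
next
  case (Conj A B)
  have h: "seg h (SConj # enc A @ enc B)" using Conj.prems(1) by simp
  show ?case
  proof (rule scan_binary[OF h])
    show "does (cwhile 2 scan_body) (h + Suc (length (enc A) + length (enc B)), v(2 := d), ou) s"
      using Conj.prems(3) by (simp only: enc.simps list.size length_append add_Suc_right add_0_right)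
  qed (use Conj.prems(2) in \<open>auto intro: Conj.IH\<close>)
next
  case (Disj A B)
  have h: "seg h (SDisj # enc A @ enc B)" using Disj.prems(1) by simp
  show ?case
  proof (rule scan_binary[OF h])
    show "does (cwhile 2 scan_body) (h + Suc (length (enc A) + length (enc B)), v(2 := d), ou) s"
      using Disj.prems(3) by (simp only: enc.simps list.size length_append add_Suc_right add_0_right)
  qed (use Disj.prems(2) in \<open>auto intro: Disj.IH\<close>)
qed

lemma does_clear_right: "does clear_right (h, v, ou) (h, v(1 := 0), ou)"
proof (induction "v 1" arbitrary: v)
  case 0
  then show ?case unfolding clear_right_def using does_cwhile_exit[of 1 v] by (simp add: fun_upd_idem)
next
  case (Suc k)
  let ?v = "v(1 := v 1 - 1)"
  have 1: "does (dec 1) (h, v, ou) (h, ?v, ou)" by (rule does_dec) (use Suc.hyps(2) in simp_all)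
  have "does clear_right (h, ?v, ou) (h, ?v(1 := 0), ou)"
    by (rule Suc.hyps(1)) (use Suc.hyps(2) in simp)
  then have 2: "does clear_right (h, ?v, ou) (h, v(1 := 0), ou)" by (simp only: fun_upd_upd)
  show ?case unfolding clear_right_def
    by (rule does_cwhile_step[OF _ _ 1 2[unfolded clear_right_def]]) (use Suc.hyps(2) in simp_all)
qed

lemma does_find_right:
  assumes "v 1 = 0" "v 2 = 0" "seg i (a # enc A @ w)"
  shows "does find_right (i, v, ou) (0, v(1 := i + 1 + length (enc A)), ou)"
proof -
  let ?j = "i + 1 + length (enc A)"
  from seg_Cons[OF assms(3)] have i: "i \<le> length x" and "seg (Suc i) (enc A @ w)"
    using read_Sy by auto
  then have A: "seg (Suc i) (enc A)" using seg_append by blast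
  have j: "?j \<le> length x + 1" using seg_length[OF A] by simp
  have v: "v(2 := 0) = v" using assms(2) by auto
  have "does (cwhile 2 scan_body) (?j, v, ou) (?j, v, ou)"
    using assms(2) by (intro does_cwhile_exit) simp_all
  then have e: "does (cwhile 2 scan_body) (Suc i + length (enc A), v(2 := 0), ou) (?j, v, ou)"
    unfolding v by (simp only: add_Suc Suc_eq_plus1 add_ac)
  have "0 + length (enc A) < M" using j M by simp
  from scan_enc[OF A this e]
  have 3: "does (cwhile 2 scan_body) (Suc i, v(2 := v 2 + 1), ou) (?j, v, ou)"
    using assms(2) by simp
  have 2: "does (inc 2) (Suc i, v, ou) (Suc i, v(2 := v 2 + 1), ou)"
    by (rule does_inc) (use assms(2) M in simp_all)
  have "does (rewind_count 1 []) (?j, v, ou) (0, v(1 := v 1 + ?j), ou @ concat (replicate ?j []))"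
    by (rule does_rewind_count) (use assms(1) j M in simp_all)
  then have 4: "does (rewind_count 1 []) (?j, v, ou) (0, v(1 := ?j), ou)"
    using assms(1) by simp
  show ?thesis unfolding find_right_def
    by (rule does_Seq[OF does_right[OF i] does_Seq[OF 2 does_Seq[OF 3 4]]])
qed

lemma does_binary_node:
  assumes "v 0 = i" "v 1 = 0" "v 2 = 0" "seg i (a # enc A @ w)"
    and "does c (0, v(1 := i + 1 + length (enc A)), ou) (h, v(1 := i + 1 + length (enc A)), ou')"
  shows "does (binary_node c) (i, v, ou) (i, v, ou')"
proof -
  have "i \<le> length x + 1" using seg_length[OF assms(4)] by simp
  then have 3: "does return_to_node (h, v, ou') (i, v, ou')"
    using does_return[of v h ou'] assms(1,3) by simp
  have "v(1 := i + 1 + length (enc A), 1 := 0) = v" using assms(2) by auto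
  with does_clear_right[of h "v(1 := i + 1 + length (enc A))" ou']
  have 2: "does clear_right (h, v(1 := i + 1 + length (enc A)), ou') (h, v, ou')" by (simp only:)
  show ?thesis unfolding binary_node_def
    by (rule does_Seq[OF does_find_right[OF assms(2-4)] does_Seq[OF assms(5) does_Seq[OF 2 3]]])
qed

lemma does_copy_bits:
  assumes "seg h (w @ [SEnd])" "set w \<subseteq> {SZero, SOne}"
  shows "does (hwhile (\<lambda>a. a \<in> Sy ` {SZero, SOne}) (copy_cell ;; head R)) (h, v, ou) (h + length w, v, ou @ w)"
  using assms
proof (induction w arbitrary: h ou)
  case Nil
  then have "read_in x h = Sy SEnd" using seg_Cons by fastforce
  then show ?case using does_hwhile_exit[of _ h] by simp
next
  case (Cons b w)
  from Cons.prems(1) have r: "read_in x h = Sy b" "seg (Suc h) (w @ [SEnd])" using seg_Cons by fastforce+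
  have 1: "does (copy_cell ;; head R) (h, v, ou) (Suc h, v, ou @ [b])"
    by (rule does_Seq[OF does_copy_cell[OF r(1)] does_right[OF read_Sy[OF r(1)]]])
  have 2: "does (hwhile (\<lambda>a. a \<in> Sy ` {SZero, SOne}) (copy_cell ;; head R)) (Suc h, v, ou @ [b])
      (h + length (b # w), v, ou @ b # w)"
    using Cons.IH[OF r(2), of "ou @ [b]"] Cons.prems(2) by simp
  show ?case by (rule does_hwhile_step[OF _ 1 2]) (use Cons.prems(2) r(1) in auto)
qed

lemma does_copy_name:
  assumes "seg i (enc (Var k))"
  shows "does copy_name (i, v, ou) (i + 1 + length (bin k), v, ou @ enc (vext k))"
proof -
  from assms seg_Cons have r: "read_in x i = Sy SVar" "seg (Suc i) (bin k @ [SEnd])" by fastforce+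
  show ?thesis unfolding copy_name_def
    by (rule does_eq, rule does_Seq[OF does_right[OF read_Sy[OF r(1)]]
        does_Seq[OF does_emits does_Seq[OF does_copy_bits[OF r(2) set_bin] does_emits]]])
      (simp add: enc_vext del: enc.simps)
qed

lemma does_var_node:
  assumes "v 0 = i" "v 1 = 0" "v 2 = 0" "seg i (enc (Var k))"
  shows "does var_node (i, v, ou) (i, v, ou @ prefixes (clauses n i (Var k)))"
proof -
  have i: "i + 1 + length (bin k) \<le> length x + 1" using seg_length[OF assms(4)] by simp
  have ret: "does return_to_node (h, v, ou) (i, v, ou)" for h ou
    using does_return[of v h ou] assms(1,3) i by simp
  have pr: "does (prints ps) (h, v, ou) (h, v, ou @ outs i 0 h ps)" if "h \<le> length x + 1" for h ou ps
    using does_prints[of v h ps ou] assms(1-3) i M that by simp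
  have "i \<le> length x + 1" using i by simp
  show ?thesis unfolding var_node_def
    by (rule does_eq, rule does_Seq[OF pr[OF \<open>i \<le> length x + 1\<close>] does_Seq[OF does_copy_name[OF assms(4)] does_Seq[OF ret
        does_Seq[OF pr[OF \<open>i \<le> length x + 1\<close>] does_Seq[OF does_copy_name[OF assms(4)] does_Seq[OF pr[OF i] ret]]]]]])
      (simp add: outs_def)
qed

lemma does_bot_node:
  assumes "v 0 = i" "v 1 = 0" "v 2 = 0" "i \<le> length x"
  shows "does bot_node (i, v, ou) (i, v, ou @ prefixes (clauses (length x) i Bot))"
proof -
  have ret: "does return_to_node (h, v, ou) (i, v, ou)" for h ou
    using does_return[of v h ou] assms by simp
  show ?thesis unfolding bot_node_def
    by (rule does_eq, rule does_Seq[OF does_rewind does_Seq[OF does_for_heads ret]])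
      (use assms M in \<open>simp_all add: outs_def prefixes_def comp_def del: upt_Suc\<close>)
qed

section \<open>The sweep over the input\<close>

abbreviation "at_node i \<equiv> (\<lambda>_. 0 :: nat)(0 := i :: nat)"

lemma node_loop_step:
  assumes "i \<le> length x" "does node (i, at_node i, ou) (i, at_node i, ou')"
    "does node_loop (Suc i, at_node (Suc i), ou') s"
  shows "does node_loop (i, at_node i, ou) s"
proof -
  have "does (inc 0) (Suc i, at_node i, ou') (Suc i, (at_node i)(0 := (at_node i) 0 + 1), ou')"
    using does_inc[of 0 "at_node i" "Suc i" ou'] assms(1) M by simp
  then have "does (inc 0) (Suc i, at_node i, ou') (Suc i, at_node (Suc i), ou')"
    by simp
  then have 1: "does (node ;; head R ;; inc 0) (i, at_node i, ou) (Suc i, at_node (Suc i), ou')"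
    by (rule does_Seq[OF assms(2) does_Seq[OF does_right[OF assms(1)]]])
  show ?thesis unfolding node_loop_def
    by (rule does_hwhile_step[OF _ 1 assms(3)[unfolded node_loop_def]]) (use assms(1) in \<open>simp add: read_REnd\<close>)
qed

lemma node_loop_skip:
  assumes "seg i w" "set w \<subseteq> {SZero, SOne, SEnd}"
    "does node_loop (i + length w, at_node (i + length w), ou) s"
  shows "does node_loop (i, at_node i, ou) s"
  using assms
proof (induction w arbitrary: i)
  case (Cons a w)
  then have r: "read_in x i = Sy a" "seg (Suc i) w" using seg_Cons by blast+
  have 1: "does node (i, at_node i, ou) (i, at_node i, ou)"
    unfolding node_def by (intro does_hif(2) does_skip) (use r(1) Cons.prems(2) in auto)
  have "i + length (a # w) = Suc i + length w" by simp
  with Cons.prems(3) have 2: "does node_loop (Suc i + length w, at_node (Suc i + length w), ou) s"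
    by (simp only:)
  have "does node_loop (Suc i, at_node (Suc i), ou) s"
    by (rule Cons.IH[OF r(2) _ 2]) (use Cons.prems(2) in simp)
  with node_loop_step[OF read_Sy[OF r(1)] 1] show ?case by blast
qed simp

lemma node_loop_binary:
  assumes "seg i (a # enc A @ enc B)" "does node (i, at_node i, ou) (i, at_node i, ou @ prefixes Cs)"
    and A: "\<And>i ou. seg i (enc A) \<Longrightarrow> does node_loop (i + length (enc A), at_node (i + length (enc A)),
        ou @ prefixes (clauses n i A)) s \<Longrightarrow> does node_loop (i, at_node i, ou) s"
    and B: "\<And>i ou. seg i (enc B) \<Longrightarrow> does node_loop (i + length (enc B), at_node (i + length (enc B)),
        ou @ prefixes (clauses n i B)) s \<Longrightarrow> does node_loop (i, at_node i, ou) s"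
    and s: "does node_loop (i + length (a # enc A @ enc B), at_node (i + length (a # enc A @ enc B)),
        ou @ prefixes (Cs @ clauses n (i + 1) A @ clauses n (i + 1 + length (enc A)) B)) s"
  shows "does node_loop (i, at_node i, ou) s"
proof -
  from seg_Cons[OF assms(1)] have r: "read_in x i = Sy a" and "seg (Suc i) (enc A @ enc B)" by blast+
  then have g: "seg (Suc i) (enc A)" "seg (Suc i + length (enc A)) (enc B)" using seg_append by blast+
  have *: "i + length (a # enc A @ enc B) = Suc i + length (enc A) + length (enc B)" by simp
  have "does node_loop (Suc i + length (enc A), at_node (Suc i + length (enc A)),
      (ou @ prefixes Cs) @ prefixes (clauses n (Suc i) A)) s"
    by (rule B[OF g(2)], rule s[unfolded *, THEN back_subst[where P = "\<lambda>st. does node_loop st s"]]) simp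
  then have "does node_loop (Suc i, at_node (Suc i), ou @ prefixes Cs) s" by (rule A[OF g(1)])
  with node_loop_step[OF read_Sy[OF r] assms(2)] show ?thesis by blast
qed

text \<open>Again in backward form. The sweep meets the nodes in the preorder in which
  \<open>clauses\<close> lists them, so the output grows by exactly the right prefixes; counters 1
  and 2 are zero between nodes, so \<open>at_node i\<close> describes the whole counter
  state.\<close>

lemma node_loop_enc:
  assumes "seg i (enc A)"
    "does node_loop (i + length (enc A), at_node (i + length (enc A)), ou @ prefixes (clauses (length x) i A)) s"
  shows "does node_loop (i, at_node i, ou) s"
  using assms
proof (induction A arbitrary: i ou)
  case (Var k)
  let ?ou = "ou @ prefixes (clauses (length x) i (Var k))"
  from Var.prems(1) have r: "read_in x i = Sy SVar" "seg (Suc i) (bin k @ [SEnd])"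
    using seg_Cons by fastforce+
  have 1: "does node (i, at_node i, ou) (i, at_node i, ?ou)"
    unfolding node_def by (rule does_hif(1)[OF _ does_var_node]) (use r(1) Var.prems(1) in simp_all)
  have *: "i + length (enc (Var k)) = Suc i + length (bin k @ [SEnd])" by simp
  have "does node_loop (Suc i, at_node (Suc i), ?ou) s"
    by (rule node_loop_skip[OF r(2) _ Var.prems(2)[unfolded *]]) (use set_bin in auto)
  with node_loop_step[OF read_Sy[OF r(1)] 1] show ?case by blast
next
  case Bot
  let ?ou = "ou @ prefixes (clauses (length x) i Bot)"
  from Bot.prems(1) have r: "read_in x i = Sy SBot" using seg_Cons by fastforce
  have 1: "does node (i, at_node i, ou) (i, at_node i, ?ou)"
    unfolding node_def by (rule does_hif(2)[OF _ does_hif(1)[OF _ does_bot_node]]) (use r read_Sy in simp_all)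
  have "i + length (enc Bot) = Suc i" by simp
  with Bot.prems(2) have "does node_loop (Suc i, at_node (Suc i), ?ou) s" by (simp only:)
  with node_loop_step[OF read_Sy[OF r] 1] show ?case by blast
next
  case (Imp A B)
  let ?j = "i + 1 + length (enc A)"
  let ?Cs = "[Imp (vpos i) (Imp (vpos (i + 1)) (vpos ?j)), Imp (Imp (vpos (i + 1)) (vpos ?j)) (vpos i)]"
  have g: "seg i (SImp # enc A @ enc B)" using Imp.prems(1) by simp
  have r: "read_in x i = Sy SImp" using seg_Cons[OF g] by blast
  have j: "?j \<le> length x + 1" using seg_length[OF g] by simp
  have "does (binary_node (prints imp_pieces)) (i, at_node i, ou) (i, at_node i, ou @ prefixes ?Cs)"
    by (rule does_binary_node[OF _ _ _ g], simp, simp, simp, rule does_eq, rule does_prints)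
      (use j M in \<open>simp_all add: outs_def imp_pieces_def\<close>)
  then have 1: "does node (i, at_node i, ou) (i, at_node i, ou @ prefixes ?Cs)"
    unfolding node_def by (intro does_hif(2)[of "\<lambda>a. a = Sy SVar"] does_hif(2)[of "\<lambda>a. a = Sy SBot"] does_hif(1)) (simp_all add: r)
  show ?case
  proof (rule node_loop_binary[OF g 1 Imp.IH])
    show "does node_loop (i + length (SImp # enc A @ enc B), at_node (i + length (SImp # enc A @ enc B)),
        ou @ prefixes (?Cs @ clauses (length x) (i + 1) A @ clauses (length x) ?j B)) s"
      using Imp.prems(2) by (simp only: enc.simps clauses.simps Let_def)
  qed
next
  case (Conj A B)
  let ?j = "i + 1 + length (enc A)"
  let ?Cs = "[Imp (vpos i) (vpos (i + 1)), Imp (vpos i) (vpos ?j), Imp (vpos (i + 1)) (Imp (vpos ?j) (vpos i))]"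
  have g: "seg i (SConj # enc A @ enc B)" using Conj.prems(1) by simp
  have r: "read_in x i = Sy SConj" using seg_Cons[OF g] by blast
  have j: "?j \<le> length x + 1" using seg_length[OF g] by simp
  have "does (binary_node (prints conj_pieces)) (i, at_node i, ou) (i, at_node i, ou @ prefixes ?Cs)"
    by (rule does_binary_node[OF _ _ _ g], simp, simp, simp, rule does_eq, rule does_prints)
      (use j M in \<open>simp_all add: outs_def conj_pieces_def\<close>)
  then have 1: "does node (i, at_node i, ou) (i, at_node i, ou @ prefixes ?Cs)"
    unfolding node_def by (intro does_hif(2)[of "\<lambda>a. a = Sy SVar"] does_hif(2)[of "\<lambda>a. a = Sy SBot"]
        does_hif(2)[of "\<lambda>a. a = Sy SImp"] does_hif(1)) (simp_all add: r)
  show ?case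
  proof (rule node_loop_binary[OF g 1 Conj.IH])
    show "does node_loop (i + length (SConj # enc A @ enc B), at_node (i + length (SConj # enc A @ enc B)),
        ou @ prefixes (?Cs @ clauses (length x) (i + 1) A @ clauses (length x) ?j B)) s"
      using Conj.prems(2) by (simp only: enc.simps clauses.simps Let_def)
  qed
next
  case (Disj A B)
  let ?j = "i + 1 + length (enc A)"
  let ?Cs = "[Imp (vpos (i + 1)) (vpos i), Imp (vpos ?j) (vpos i)] @
    map (\<lambda>r. Imp (vpos i) (Imp (Imp (vpos (i + 1)) (vpos r)) (Imp (Imp (vpos ?j) (vpos r)) (vpos r)))) [0..<Suc (length x)]"
  have g: "seg i (SDisj # enc A @ enc B)" using Disj.prems(1) by simp
  have r: "read_in x i = Sy SDisj" using seg_Cons[OF g] by blast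
  have j: "?j \<le> length x + 1" using seg_length[OF g] by simp
  have "does (binary_node (prints disj_pieces ;; for_heads cases_pieces)) (i, at_node i, ou) (i, at_node i, ou @ prefixes ?Cs)"
    by (rule does_binary_node[OF _ _ _ g], simp, simp, simp, rule does_eq, rule does_Seq[OF does_prints does_for_heads])
      (use j M in \<open>simp_all add: outs_def disj_pieces_def cases_pieces_def prefixes_def comp_def del: upt_Suc\<close>)
  then have 1: "does node (i, at_node i, ou) (i, at_node i, ou @ prefixes ?Cs)"
    unfolding node_def by (intro does_hif(2)[of "\<lambda>a. a = Sy SVar"] does_hif(2)[of "\<lambda>a. a = Sy SBot"]
        does_hif(2)[of "\<lambda>a. a = Sy SImp"] does_hif(2)[of "\<lambda>a. a = Sy SConj"] does_hif(1)) (simp_all add: r)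
  show ?case
  proof (rule node_loop_binary[OF g 1 Disj.IH])
    show "does node_loop (i + length (SDisj # enc A @ enc B), at_node (i + length (SDisj # enc A @ enc B)),
        ou @ prefixes (?Cs @ clauses (length x) (i + 1) A @ clauses (length x) ?j B)) s"
      using Disj.prems(2) by (simp only: enc.simps clauses.simps Let_def append_assoc)
  qed
qed

end

section \<open>The space bound and the conclusion\<close>

lemma transl_com_computes:
  "computes_logspace (machine transl_com) 20 (enc \<phi>) (enc (transl \<phi>))"
proof -
  let ?x = "enc \<phi>" and ?n = "length (enc \<phi>)"
  define l where "l = log 2 (real ?n + 2)"
  \<comment> \<open>At most \<open>1 + l\<close> blocks of five cells, and ten cells to spare for
    moves within a block.\<close>
  define W where "W = nat \<lfloor>5 * (1 + l) + 10\<rfloor>"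
  have l: "1 \<le> l" unfolding l_def using log_le_cancel_iff[of 2 2 "real ?n + 2"] by simp
  have "real W \<le> 5 * (1 + l) + 10" unfolding W_def by (rule of_nat_floor) (use l in simp)
  \<comment> \<open>The origin of the factor 20: the left side is \<open>5 * l + 15\<close>, and
    \<open>1 \<le> l\<close> absorbs the constant.\<close>
  moreover have "5 * (1 + l) + 10 \<le> 20 * l" using l by (simp add: algebra_simps)
  ultimately have W_le: "real W \<le> 20 * l" by (rule order_trans)
  have bound: "5 * u + 10 \<le> W" if "2 ^ u \<le> 2 * (?n + 2)" for u
  proof -
    have "real (2 ^ u) \<le> real (2 * (?n + 2))" using that of_nat_le_iff by blast
    then have "2 powr real u \<le> 2 * (real ?n + 2)" by (simp add: powr_realpow)
    then have "real u \<le> log 2 (2 * (real ?n + 2))" by (simp add: le_log_iff)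
    also have "\<dots> = 1 + l" by (subst log_mult) (simp_all add: l_def)
    finally show ?thesis unfolding W_def by (intro le_nat_floor) simp
  qed
  interpret transducer ?x "?n + 2" W by standard (use bound in auto)
  have g: "seg 1 ?x" unfolding seg_def by (intro exI[of _ "[]"]) simp
  let ?p = "prefixes (clauses ?n 1 \<phi>)"
  let ?e = "1 + ?n"
  have "does node_loop (?e, at_node ?e, [] @ ?p) (?e, at_node ?e, ?p)"
    unfolding node_loop_def using does_hwhile_exit[of "\<lambda>a. a \<noteq> REnd" ?e] by (simp add: read_REnd)
  from node_loop_enc[OF g this] have 3: "does node_loop (1, at_node 1, []) (?e, at_node ?e, ?p)" .
  have "does (inc 0) (Suc 0, (\<lambda>_. 0), []) (Suc 0, (\<lambda>_. 0)(0 := (\<lambda>_. 0) 0 + 1), [])"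
    using does_inc[of 0 "\<lambda>_. 0" "Suc 0" "[]"] by simp
  then have 2: "does (inc 0) (Suc 0, (\<lambda>_. 0), []) (1, at_node 1, [])" by simp
  have d: "does (head R ;; inc 0 ;; node_loop ;; emits (enc (vpos 1))) (0, (\<lambda>_. 0), [])
      (?e, at_node ?e, ?p @ enc (vpos 1))"
    by (rule does_Seq[OF does_right does_Seq[OF 2 does_Seq[OF 3 does_emits]]]) simp
  \<comment> \<open>The first action writes the left end mark; with no block in use, the blank rest
    already represents three counters with value zero.\<close>
  let ?t = "(\<lambda>_. False)(0 := True)"
  have "rep 0 (\<lambda>_. 0) ?t" by (auto simp: rep_def num_def)
  then have "models (False, 0, ?t, 0, []) (0, (\<lambda>_. 0), [])"
    by (subst models.simps) (auto intro!: exI[of _ 0])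
  with d obtain m where m: "exec W ?x (head R ;; inc 0 ;; node_loop ;; emits (enc (vpos 1))) (False, 0, ?t, 0, []) m"
    "models m (?e, at_node ?e, ?p @ enc (vpos 1))" unfolding does_def by blast
  obtain f h tp w out0 where mm: "m = (f, h, tp, w, out0)" by (cases m)
  have "exec W ?x (put_bit True) (False, 0, \<lambda>_. False, 0, []) (False, 0, ?t, 0, [])"
    by (rule exec_put_bit) simp
  then have "exec W ?x transl_com (False, 0, \<lambda>_. False, 0, []) (f, h, tp, w, out0)"
    using m(1) unfolding transl_com_def mm by (rule exec_Seq)
  moreover have "out0 = enc (transl \<phi>)"
    using m(2) unfolding mm models.simps by (simp add: transl_def enc_foldr_Imp del: enc.simps)
  ultimately show ?thesis using exec_computes W_le unfolding l_def by blast
qed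

theorem theorem3p12:
  "\<exists>f :: form \<Rightarrow> form. logspace_form_fun f \<and>
     (\<forall>\<phi>. implicational (f \<phi>) \<and> order (f \<phi>) \<le> 3 \<and>
           (provable (f \<phi>) \<longleftrightarrow> provable \<phi>))"
  unfolding logspace_form_fun_def
  using wf_machine_machine transl_com_computes transl_shape transl_sound transl_complete by blast

end
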